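(* Let $n$ be a positive integer, $K$ a field with $\mathrm{char}(K)=0$ or $\mathrm{char}(K)>n$, and $A$ a commutative $K$-algebra with identity $1$. Let $\mathcal{M}\subset A$ be a subset such that $1\notin\mathcal{M}$ and $\{1\}\cup\mathcal{M}$ is a $K$-vector space basis of $A$. Let $\mathcal{F}=K[T_w\mid w\in\mathcal{M}]$ be the commutative polynomial algebra in indeterminates $T_w$ indexed by $\mathcal{M}$, and let $\varphi:\mathcal{F}\to T^n(A)^{S_n}$ be the $K$-algebra homomorphism with $\varphi(T_w)=[w]$ for all $w\in\mathcal{M}$. Then $\varphi$ is surjective onto $T^n(A)^{S_n}$, and its kernel is the ideal of $\mathcal{F}$ generated by the elements $\Psi_{\{w_1,\ldots,w_{n+1}\}}$, where $\{w_1,\ldots,w_{n+1}\}$ ranges over all multisets of $n+1$ elements of $\mathcal{M}$.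
   Context: $T^n(A)$ is the $n$th tensor power $A\otimes_K\cdots\otimes_K A$ (a commutative $K$-algebra), on which the symmetric group $S_n$ acts by permuting the tensor factors; $T^n(A)^{S_n}$ is the subalgebra of $S_n$-invariants. For $w\in A$, $$[w]:=w\otimes 1\otimes\cdots\otimes 1+1\otimes w\otimes 1\otimes\cdots\otimes 1+\cdots+1\otimes\cdots\otimes 1\otimes w\in T^n(A)^{S_n}.$$ For a general element $a\in A$, written as $a=c_0+\sum_{w\in\mathcal{M}}c_w w$ with $c_0,c_w\in K$ (finitely many nonzero), set $T_a:=c_0 n+\sum_{w\in\mathcal{M}}c_wT_w\in\mathcal{F}$. Let $\mathcal{P}_{n+1}$ be the set of partitions $\lambda=\lambda_1\bigcup\cdots\bigcup\lambda_h$ of the set $\{1,\ldots,n+1\}$ into a disjoint union of non-empty subsets $\lambda_i$, and write $h(\lambda)=h$ for the number of parts. For a multiset $\{w_1,\ldots,w_{n+1}\}$ of $n+1$ elements of $\mathcal{M}$ define $$\Psi_{\{w_1,\ldots,w_{n+1}\}}:=\sum_{\lambda\in\mathcal{P}_{n+1}}(-1)^{h(\lambda)}\prod_{i=1}^{h(\lambda)}\Bigl((|\lambda_i|-1)!\cdot T_{\prod_{s\in\lambda_i}w_s}\Bigr)\in\mathcal{F},$$ where the product $\prod_{s\in\lambda_i}w_s$ is taken in $A$. *)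

theory Defs
  imports
    Complex_Main
    "HOL-Library.Poly_Mapping"
    "HOL-Library.Disjoint_Sets"
    "HOL-Combinatorics.Permutations"
    "HOL-Algebra.Module"
    "HOL-Algebra.QuotRing"
begin

locale commutative_algebra = vector_space scale
  for scale :: "'k::field \<Rightarrow> 'a::comm_ring_1 \<Rightarrow> 'a" +
  assumes scale_mult_left: "scale c x * y = scale c (x * y)"

definition algebra_hom ::
    "('k, 'b, 'm) module_scheme \<Rightarrow> ('k, 'c, 'n) module_scheme \<Rightarrow> ('b \<Rightarrow> 'c) set" where
  "algebra_hom R S =
     {h \<in> ring_hom R S. \<forall>c. \<forall>x\<in>carrier R. h (c \<odot>\<^bsub>R\<^esub> x) = c \<odot>\<^bsub>S\<^esub> h x}"


subsection \<open>Polynomial algebras\<close>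

text \<open>A monomial is a finitely supported exponent function \<open>'v \<Rightarrow>\<^sub>0 nat\<close>, a polynomial is a
  finitely supported coefficient function on monomials, and the product is the convolution
  product of the library.\<close>

type_synonym ('v, 'k) mpoly = "('v \<Rightarrow>\<^sub>0 nat) \<Rightarrow>\<^sub>0 'k"

definition Const :: "'k::zero \<Rightarrow> ('v, 'k) mpoly" where
  "Const c = Poly_Mapping.single 0 c"

definition Var :: "'v \<Rightarrow> ('v, 'k::zero_neq_one) mpoly" where
  "Var v = Poly_Mapping.single (Poly_Mapping.single v 1) 1"

definition poly_algebra :: "'v set \<Rightarrow> ('k::field, ('v, 'k) mpoly) module" where
  "poly_algebra V =
     \<lparr>carrier = {p. \<forall>m\<in>Poly_Mapping.keys p. Poly_Mapping.keys m \<subseteq> V},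
      mult = (*), one = 1, zero = 0, add = (+), smult = (\<lambda>c p. Const c * p)\<rparr>"


subsection \<open>Tensor powers\<close>

text \<open>The tensor power is the quotient of the vector space with basis \<open>A\<^sup>n\<close> (lists of length
  \<open>n\<close>) by the subspace spanned by the multilinearity relations; the factors are multiplied
  componentwise.\<close>

type_synonym ('a, 'k) formal_tensor = "'a list \<Rightarrow>\<^sub>0 'k"

definition formal_scale :: "'k::field \<Rightarrow> ('a, 'k) formal_tensor \<Rightarrow> ('a, 'k) formal_tensor" where
  "formal_scale c f = Poly_Mapping.map (\<lambda>d. c * d) f"

definition formal_pure :: "'a list \<Rightarrow> ('a, 'k::field) formal_tensor" where
  "formal_pure xs = Poly_Mapping.single xs 1"

definition formal_mult ::
    "('a::comm_ring_1, 'k::field) formal_tensor \<Rightarrow> ('a, 'k) formal_tensor \<Rightarrow> ('a, 'k) formal_tensor" where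
  "formal_mult f g =
     (\<Sum>xs\<in>Poly_Mapping.keys f. \<Sum>ys\<in>Poly_Mapping.keys g.
        Poly_Mapping.single (map2 (*) xs ys)
          (Poly_Mapping.lookup f xs * Poly_Mapping.lookup g ys))"

definition formal_tensors :: "nat \<Rightarrow> ('a::comm_ring_1, 'k::field) formal_tensor ring" where
  "formal_tensors n =
     \<lparr>carrier = {f. \<forall>xs\<in>Poly_Mapping.keys f. length xs = n},
      mult = formal_mult, one = formal_pure (replicate n 1), zero = 0, add = (+)\<rparr>"

definition multilinearity_relations ::
    "('k::field \<Rightarrow> 'a::comm_ring_1 \<Rightarrow> 'a) \<Rightarrow> nat \<Rightarrow> ('a, 'k) formal_tensor set" where
  "multilinearity_relations scale n =
     {formal_pure (xs[i := x + y]) - formal_pure (xs[i := x]) - formal_pure (xs[i := y])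
        | xs i x y. length xs = n \<and> i < n} \<union>
     {formal_pure (xs[i := scale c x]) - formal_scale c (formal_pure (xs[i := x]))
        | xs i c x. length xs = n \<and> i < n}"

definition null_tensors ::
    "('k::field \<Rightarrow> 'a::comm_ring_1 \<Rightarrow> 'a) \<Rightarrow> nat \<Rightarrow> ('a, 'k) formal_tensor set" where
  "null_tensors scale n = module.span formal_scale (multilinearity_relations scale n)"

definition tensor_class ::
    "('k::field \<Rightarrow> 'a::comm_ring_1 \<Rightarrow> 'a) \<Rightarrow> nat \<Rightarrow> ('a, 'k) formal_tensor \<Rightarrow>
       ('a, 'k) formal_tensor set" where
  "tensor_class scale n f = null_tensors scale n +>\<^bsub>formal_tensors n\<^esub> f"

text \<open>The scalar multiplication is written as a union over all representatives, in the same way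
  as the product of cosets in \<^const>\<open>FactRing\<close>, because the image of a coset under
  multiplication by \<open>0\<close> is not a coset.\<close>

definition tensor_power ::
    "('k::field \<Rightarrow> 'a::comm_ring_1 \<Rightarrow> 'a) \<Rightarrow> nat \<Rightarrow> ('k, ('a, 'k) formal_tensor set) module" where
  "tensor_power scale n =
     (let Q = formal_tensors n Quot null_tensors scale n in
      \<lparr>carrier = carrier Q, mult = mult Q, one = one Q, zero = zero Q, add = add Q,
       smult = (\<lambda>c X. \<Union>f\<in>X. tensor_class scale n (formal_scale c f))\<rparr>)"

definition pure_tensor ::
    "('k::field \<Rightarrow> 'a::comm_ring_1 \<Rightarrow> 'a) \<Rightarrow> 'a list \<Rightarrow> ('a, 'k) formal_tensor set" where
  "pure_tensor scale xs = tensor_class scale (length xs) (formal_pure xs)"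

definition permute_formal ::
    "(nat \<Rightarrow> nat) \<Rightarrow> ('a, 'k::field) formal_tensor \<Rightarrow> ('a, 'k) formal_tensor" where
  "permute_formal \<sigma> f =
     (\<Sum>xs\<in>Poly_Mapping.keys f. Poly_Mapping.single (permute_list \<sigma> xs) (Poly_Mapping.lookup f xs))"

text \<open>A permutation maps the relations bijectively to the relations, so its action on a coset is
  the image of that coset.\<close>

definition symmetric_tensors ::
    "('k::field \<Rightarrow> 'a::comm_ring_1 \<Rightarrow> 'a) \<Rightarrow> nat \<Rightarrow> ('k, ('a, 'k) formal_tensor set) module" where
  "symmetric_tensors scale n =
     (tensor_power scale n)
       \<lparr>carrier := {X \<in> carrier (tensor_power scale n).
                     \<forall>\<sigma>. \<sigma> permutes {..<n} \<longrightarrow> permute_formal \<sigma> ` X = X}\<rparr>"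

definition tensor_bracket ::
    "('k::field \<Rightarrow> 'a::comm_ring_1 \<Rightarrow> 'a) \<Rightarrow> nat \<Rightarrow> 'a \<Rightarrow> ('a, 'k) formal_tensor set" where
  "tensor_bracket scale n w =
     (\<Oplus>\<^bsub>tensor_power scale n\<^esub>i\<in>{..<n}. pure_tensor scale ((replicate n 1)[i := w]))"


subsection \<open>The relations between the power sums\<close>

definition T_elem ::
    "('k::field \<Rightarrow> 'a::comm_ring_1 \<Rightarrow> 'a) \<Rightarrow> 'a set \<Rightarrow> nat \<Rightarrow> 'a \<Rightarrow> ('a, 'k) mpoly" where
  "T_elem scale M n a =
     (let c = module.representation scale (insert 1 M) a in
      Const (c 1 * of_nat n) + (\<Sum>w | w \<in> M \<and> c w \<noteq> 0. Const (c w) * Var w))"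

definition Psi ::
    "('k::field \<Rightarrow> 'a::comm_ring_1 \<Rightarrow> 'a) \<Rightarrow> 'a set \<Rightarrow> nat \<Rightarrow> (nat \<Rightarrow> 'a) \<Rightarrow> ('a, 'k) mpoly" where
  "Psi scale M n w =
     (\<Sum>P | partition_on {1..n + 1} P.
        (-1) ^ card P *
        (\<Prod>B\<in>P. of_nat (fact (card B - 1)) * T_elem scale M n (\<Prod>s\<in>B. w s)))"

end

theory Submission
  imports Defs
begin

text \<open>Write \<open>P(w\<^sub>1,\<dots>,w\<^sub>m)\<close> for the polynomial \<open>\<Psi>\<close> formed with any number \<open>m\<close> of arguments from \<open>A\<close>,
  that is \<open>cycle_sum (T_elem scale M n) S w\<close> with an index set \<open>S\<close> of size \<open>m\<close>. It is symmetric,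
  and it is multilinear because \<open>a \<mapsto> T\<^sub>a\<close> is linear. Everything rests on the recursion
  (\<open>cycle_sum_insert\<close>)
  \<open>P(w\<^sub>1,\<dots>,w\<^sub>m,a) = - T\<^sub>a P(w\<^sub>1,\<dots>,w\<^sub>m) + (\<Sum>j. P(w\<^sub>1,\<dots>,w\<^sub>j a,\<dots>,w\<^sub>m))\<close>.

  Let \<open>D(w\<^sub>1,\<dots>,w\<^sub>m)\<close> be the sum of the pure tensors that carry \<open>w\<^sub>1,\<dots>,w\<^sub>m\<close> in pairwise distinct
  slots and \<open>1\<close> in the others. Multiplying \<open>D(w\<^sub>1,\<dots>,w\<^sub>m)\<close> by \<open>[a]\<close> puts \<open>a\<close> either into a free slot or
  onto some \<open>w\<^sub>j\<close>, so \<open>D\<close> satisfies the same recursion up to sign, and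
  \<open>\<phi>(P(w\<^sub>1,\<dots>,w\<^sub>m)) = (-1)\<^sup>m D(w\<^sub>1,\<dots>,w\<^sub>m)\<close> (\<open>represents_cycle_sum\<close>). If \<open>m > n\<close>, there are no
  distinct slots and \<open>D = 0\<close>; hence the \<open>\<Psi>\<close> lie in the kernel. If \<open>m = n\<close>, then \<open>D\<close> is the sum of
  all permutations of \<open>w\<^sub>1 \<otimes> \<dots> \<otimes> w\<^sub>n\<close>.

  By multilinearity the pure tensor \<open>w\<^sub>1 \<otimes> \<dots> \<otimes> w\<^sub>n\<close> can be sent to \<open>P(w\<^sub>1,\<dots>,w\<^sub>n)\<close>; this gives a
  linear map \<open>polarize\<close> from the tensor power back to the polynomials. The composite
  \<open>\<phi> \<circ> polarize\<close> is \<open>(-1)\<^sup>n\<close> times the sum over all permutations, which is multiplication by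
  \<open>(-1)\<^sup>n n!\<close> on symmetric tensors. As \<open>n!\<close> is invertible, \<open>\<phi>\<close> is surjective
  (\<open>symmetric_tensor_in_image\<close>).

  For the kernel, let \<open>I\<close> be the ideal generated by the \<open>\<Psi>\<close>. Every polynomial is congruent modulo
  \<open>I\<close> to some \<open>polarize f\<close> (\<open>polynomial_normal_form\<close>): the leading term of \<open>P(w\<^sub>1,\<dots>,w\<^sub>m)\<close> is
  \<open>\<plusminus> T\<^sub>w\<^sub>1 \<cdots> T\<^sub>w\<^sub>m\<close> and its other terms are products of fewer factors, so by induction it is enough to
  treat the \<open>P(w\<^sub>1,\<dots>,w\<^sub>m)\<close>. Those with \<open>m > n\<close> lie in \<open>I\<close>, and those with \<open>m < n\<close> reduce to \<open>m = n\<close>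
  by filling up with ones, since \<open>P(w\<^sub>1,\<dots>,w\<^sub>m,1) = - (n - m) P(w\<^sub>1,\<dots>,w\<^sub>m)\<close>. If now
  \<open>p = polarize f + q\<close> with \<open>q \<in> I\<close> and \<open>\<phi>(p) = 0\<close>, then the symmetrization of \<open>f\<close> vanishes in the
  tensor power. Applying \<open>polarize\<close>, which does not see the order of the factors, gives
  \<open>n! polarize f = 0\<close>, so \<open>p = q \<in> I\<close> (\<open>kernel_subset_relation_ideal\<close>).\<close>

section \<open>Cycle sums over set partitions\<close>

text \<open>The factor \<open>(|B| - 1)!\<close> counts the cyclic orders on the block \<open>B\<close>, so this is the sum over all
  permutations of \<open>S\<close>, taken with the sign \<open>(-1)\<close> to the number of cycles, of the product of the
  values of \<open>x\<close> at the cycles. If \<open>x\<close> is a trace, it is up to a scalar the polarized form of a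
  coefficient of the characteristic polynomial. The polynomials \<open>\<Psi>\<close> are the case where \<open>S\<close> has
  \<open>n + 1\<close> elements and \<open>x\<close> is \<open>a \<mapsto> T\<^sub>a\<close>.\<close>

definition cycle_sum :: "('a::comm_monoid_mult \<Rightarrow> 'r::comm_ring_1) \<Rightarrow> 'i set \<Rightarrow> ('i \<Rightarrow> 'a) \<Rightarrow> 'r" where
  "cycle_sum x S w =
     (\<Sum>P | partition_on S P.
        (-1) ^ card P * (\<Prod>B\<in>P. of_nat (fact (card B - 1)) * x (\<Prod>s\<in>B. w s)))"

lemma cycle_sum_cong:
  assumes "\<And>s. s \<in> S \<Longrightarrow> w s = w' s"
  shows "cycle_sum x S w = cycle_sum x S w'"
proof -
  have "(\<Prod>s\<in>B. w s) = (\<Prod>s\<in>B. w' s)" if "partition_on S P" "B \<in> P" for P B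
    using that assms by (intro prod.cong) (auto simp: partition_on_def)
  then show ?thesis
    unfolding cycle_sum_def by (intro sum.cong refl arg_cong2[where f = "(*)"] prod.cong) auto
qed

lemma cycle_sum_empty: "cycle_sum x {} w = 1"
  by (simp add: cycle_sum_def partition_on_empty)

lemma partition_on_image:
  assumes "inj_on h T" "partition_on T P"
  shows "partition_on (h ` T) ((`) h ` P)"
proof -
  have "(`) h ` P - {{}} = (`) h ` P"
    using assms(2) by (auto simp: partition_on_def)
  then show ?thesis using partition_on_inj_image[OF assms(2,1)] by simp
qed

text \<open>Besides changing index sets, this shows that the cycle sum is symmetric in its arguments: take for
  \<open>f\<close> a permutation of \<open>S\<close>.\<close>

lemma cycle_sum_reindex:
  assumes f: "inj_on f S"
  shows "cycle_sum x (f ` S) w = cycle_sum x S (w \<circ> f)"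
proof -
  let ?g = "inv_into S f"
  have g: "inj_on ?g (f ` S)" by (simp add: inj_on_inv_into)
  have gf: "?g ` f ` B = B" if "B \<subseteq> S" for B
    using f that by (rule inv_into_image_cancel)
  have fg: "f ` ?g ` B = B" if "B \<subseteq> f ` S" for B
    using that by (simp add: image_inv_into_cancel)
  have sub: "B \<subseteq> T" if "partition_on T P" "B \<in> P" for B and T :: "'z set" and P
    using that by (auto simp: partition_on_def)
  have cancel1: "(`) ?g ` (`) f ` P = P" if "partition_on S P" for P
  proof -
    have "(\<lambda>B. ?g ` f ` B) ` P = (\<lambda>B. B) ` P"
      by (rule image_cong[OF refl]) (simp add: gf[OF sub[OF that]])
    then show ?thesis by (simp add: image_image)
  qed
  have cancel2: "(`) f ` (`) ?g ` P = P" if "partition_on (f ` S) P" for P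
  proof -
    have "(\<lambda>B. f ` ?g ` B) ` P = (\<lambda>B. B) ` P"
      by (rule image_cong[OF refl]) (simp add: fg[OF sub[OF that]])
    then show ?thesis by (simp add: image_image)
  qed
  have val: "(-1) ^ card ((`) f ` P)
      * (\<Prod>B\<in>(`) f ` P. of_nat (fact (card B - 1)) * x (\<Prod>s\<in>B. w s))
    = (-1) ^ card P * (\<Prod>B\<in>P. of_nat (fact (card B - 1)) * x (\<Prod>s\<in>B. (w \<circ> f) s))"
    if P: "partition_on S P" for P
  proof -
    have inj: "inj_on ((`) f) P"
      by (rule inj_on_inverseI[where g = "(`) ?g"]) (simp add: gf[OF sub[OF P]])
    have fB: "inj_on f B" if "B \<in> P" for B
      using f sub[OF P that] by (rule inj_on_subset)
    have "of_nat (fact (card (f ` B) - 1)) * x (\<Prod>s\<in>f ` B. w s)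
        = of_nat (fact (card B - 1)) * x (\<Prod>s\<in>B. (w \<circ> f) s)" if "B \<in> P" for B
      using card_image[OF fB[OF that]] prod.reindex[OF fB[OF that], of w] by simp
    then have "(\<Prod>B\<in>P. of_nat (fact (card (f ` B) - 1)) * x (\<Prod>s\<in>f ` B. w s))
        = (\<Prod>B\<in>P. of_nat (fact (card B - 1)) * x (\<Prod>s\<in>B. (w \<circ> f) s))"
      by (rule prod.cong[OF refl])
    then show ?thesis
      unfolding card_image[OF inj] prod.reindex[OF inj] comp_def by simp
  qed
  have "(\<Sum>P | partition_on S P.
        (-1) ^ card P * (\<Prod>B\<in>P. of_nat (fact (card B - 1)) * x (\<Prod>s\<in>B. (w \<circ> f) s)))
     = (\<Sum>P | partition_on (f ` S) P.
        (-1) ^ card P * (\<Prod>B\<in>P. of_nat (fact (card B - 1)) * x (\<Prod>s\<in>B. w s)))"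
  proof (rule sum.reindex_bij_witness[where i = "(`) ((`) ?g)" and j = "(`) ((`) f)"])
    show "(`) ?g ` (`) f ` P = P" if "P \<in> {P. partition_on S P}" for P
      using cancel1 that by simp
    show "(`) f ` P \<in> {P. partition_on (f ` S) P}" if "P \<in> {P. partition_on S P}" for P
      using partition_on_image[OF f] that by simp
    show "(`) f ` (`) ?g ` P = P" if "P \<in> {P. partition_on (f ` S) P}" for P
      using cancel2 that by simp
    show "(`) ?g ` P \<in> {P. partition_on S P}" if "P \<in> {P. partition_on (f ` S) P}" for P
      using partition_on_image[OF g, of P] that by (simp add: gf)
    show "(-1) ^ card ((`) f ` P) * (\<Prod>B\<in>(`) f ` P. of_nat (fact (card B - 1)) * x (\<Prod>s\<in>B. w s))
        = (-1) ^ card P * (\<Prod>B\<in>P. of_nat (fact (card B - 1)) * x (\<Prod>s\<in>B. (w \<circ> f) s))"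
      if "P \<in> {P. partition_on S P}" for P
      using that by (intro val) simp
  qed
  then show ?thesis by (simp add: cycle_sum_def)
qed

lemma partition_on_exchange:
  assumes P: "partition_on S P" and B: "B \<in> P" and C: "C \<noteq> {}" "disjnt C (S - B)"
  shows "partition_on (S - B \<union> C) (insert C (P - {B}))"
proof -
  have U: "\<Union>(P - {B}) = S - B"
    using P B by (auto simp: partition_on_def disjoint_def)
  have "partition_on (S - B) (P - {B})"
    unfolding partition_on_def U using P by (auto simp: partition_on_def pairwise_def)
  moreover have "S - B \<union> C - C = S - B"
    using C(2) by (auto simp: disjnt_def)
  ultimately show ?thesis
    using C by (subst partition_on_insert) (simp_all add: U)
qed

text \<open>A partition of \<open>insert a S\<close> comes from a unique partition of \<open>S\<close>: either \<open>a\<close> is a block of its own,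
  or it was added to one of the blocks.\<close>

lemma sum_partitions_insert:
  assumes "finite S" "a \<notin> S"
  shows "(\<Sum>P | partition_on (insert a S) P. F P) =
    (\<Sum>P | partition_on S P. F (insert {a} P)) +
    (\<Sum>P | partition_on S P. \<Sum>B\<in>P. F (insert (insert a B) (P - {B})))"
    (is "_ = _ + ?R")
proof -
  let ?Q = "{P. partition_on (insert a S) P}"
  have fin: "finite ?Q" using assms by (intro finitely_many_partition_on) auto
  have "sum F ?Q = sum F {P \<in> ?Q. {a} \<in> P} + sum F {P \<in> ?Q. {a} \<notin> P}"
    using fin by (subst sum.union_disjoint[symmetric]) (auto intro: sum.cong)
  also have "sum F {P \<in> ?Q. {a} \<in> P} = (\<Sum>P | partition_on S P. F (insert {a} P))"
  proof (rule sum.reindex_bij_witness[where i = "insert {a}" and j = "\<lambda>P. P - {{a}}"])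
    fix P assume P: "P \<in> {P \<in> ?Q. {a} \<in> P}"
    have "partition_on (insert a S) (insert {a} (P - {{a}}))"
      using P by (simp add: insert_absorb)
    then have "partition_on (insert a S - {a}) (P - {{a}})"
      using P partition_on_insert[of "{a}" "P - {{a}}" "insert a S"]
      by (auto simp: partition_on_def disjoint_def disjnt_def)
    then show "P - {{a}} \<in> {P. partition_on S P}" using assms by simp
    show "insert {a} (P - {{a}}) = P" using P by auto
    then show "F (insert {a} (P - {{a}})) = F P" by simp
  next
    fix P assume P: "P \<in> {P. partition_on S P}"
    have a: "a \<notin> \<Union>P" using P assms by (auto simp: partition_on_def)
    then show "insert {a} P - {{a}} = P" by auto
    show "insert {a} P \<in> {P \<in> ?Q. {a} \<in> P}"
      using P a by (auto simp: partition_on_def disjoint_def)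
  qed
  also have "sum F {P \<in> ?Q. {a} \<notin> P} = ?R"
  proof -
    \<comment> \<open>Partitions of \<open>S\<close> with a marked block, which receives \<open>a\<close>; conversely the block of \<open>a\<close> loses \<open>a\<close> and is marked.\<close>
    let ?D = "SIGMA P:{P. partition_on S P}. P"
    have finD: "finite P" if "partition_on S P" for P
      using assms(1) that by (rule finite_elements)
    have "?R = (\<Sum>(P, B)\<in>?D. F (insert (insert a B) (P - {B})))"
      using assms by (subst sum.Sigma) (auto intro: finitely_many_partition_on finD)
    also have "\<dots> = sum F {P \<in> ?Q. {a} \<notin> P}"
    proof (rule sum.reindex_bij_witness[where
          j = "\<lambda>(P, B). insert (insert a B) (P - {B})" and
          i = "\<lambda>Q. let C = (THE C. C \<in> Q \<and> a \<in> C) in (insert (C - {a}) (Q - {C}), C - {a})"])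
      fix z assume "z \<in> ?D"
      then obtain P B where z: "z = (P, B)" and P: "partition_on S P" and B: "B \<in> P" by auto
      let ?Q' = "insert (insert a B) (P - {B})"
      have a: "a \<notin> C" if "C \<in> P" for C
        using P that assms by (auto simp: partition_on_def)
      have "(THE C. C \<in> ?Q' \<and> a \<in> C) = insert a B"
        using a by (intro the_equality) auto
      moreover have "insert a B - {a} = B" using a[OF B] by auto
      moreover have "insert B (?Q' - {insert a B}) = P"
      proof -
        have "insert a B \<notin> P" using a by auto
        then have "?Q' - {insert a B} = P - {B}" by auto
        then show ?thesis using B by (simp add: insert_absorb)
      qed
      ultimately show "(let C = (THE C. C \<in> (case z of (P, B) \<Rightarrow> insert (insert a B) (P - {B})) \<and> a \<in> C)
          in (insert (C - {a}) ((case z of (P, B) \<Rightarrow> insert (insert a B) (P - {B})) - {C}), C - {a})) = z"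
        by (simp add: z Let_def)
      have "B \<noteq> {}" using P B by (auto simp: partition_on_def)
      then have "{a} \<notin> ?Q'" using a B by auto
      moreover have "partition_on (insert a S) ?Q'"
      proof -
        have "S - B \<union> insert a B = insert a S" using P B by (auto simp: partition_on_def)
        moreover have "disjnt (insert a B) (S - B)" using assms by (auto simp: disjnt_def)
        ultimately show ?thesis using partition_on_exchange[OF P B, of "insert a B"] by simp
      qed
      ultimately show "(case z of (P, B) \<Rightarrow> insert (insert a B) (P - {B})) \<in> {P \<in> ?Q. {a} \<notin> P}"
        by (simp add: z)
    next
      fix Q assume Q: "Q \<in> {P \<in> ?Q. {a} \<notin> P}"
      then have "a \<in> \<Union>Q" by (auto simp: partition_on_def)
      then obtain C where C: "C \<in> Q" "a \<in> C" by auto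
      have disj: "D \<inter> C = {}" if "D \<in> Q" "D \<noteq> C" for D
        using Q that C(1) by (simp add: partition_on_def disjoint_def)
      have uniq: "C' = C" if "C' \<in> Q" "a \<in> C'" for C'
      proof (rule ccontr)
        assume "C' \<noteq> C"
        then have "C' \<inter> C = {}" using disj that by simp
        then show False using that(2) C(2) by (simp add: disjoint_iff)
      qed
      have the: "(THE C. C \<in> Q \<and> a \<in> C) = C"
        by (rule the_equality) (simp_all add: C uniq)
      have ins: "insert a (C - {a}) = C" using C by auto
      have ne: "C - {a} \<noteq> {}" 
      proof
        assume "C - {a} = {}"
        then have "C = {a}" using C(2) by blast
        then show False using C(1) Q by simp
      qed
      have nin: "C - {a} \<notin> Q - {C}"
      proof
        assume "C - {a} \<in> Q - {C}"
        then have "(C - {a}) \<inter> C = {}" using disj by simp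
        then show False using ne by auto
      qed
      have "insert C (insert (C - {a}) (Q - {C}) - {C - {a}}) = Q"
        using nin C(1) by (simp add: insert_absorb)
      then show "(case let C = (THE C. C \<in> Q \<and> a \<in> C) in (insert (C - {a}) (Q - {C}), C - {a})
          of (P, B) \<Rightarrow> insert (insert a B) (P - {B})) = Q"
        by (simp add: the Let_def insert_absorb[OF C(2)])
      have "partition_on S (insert (C - {a}) (Q - {C}))"
      proof -
        have QP: "partition_on (insert a S) Q" using Q by simp
        have "insert a S - C \<union> (C - {a}) = S"
          using C QP assms by (auto simp: partition_on_def)
        moreover have "disjnt (C - {a}) (insert a S - C)" by (auto simp: disjnt_def)
        ultimately show ?thesis using partition_on_exchange[OF QP C(1) ne] by simp
      qed
      then show "(let C = (THE C. C \<in> Q \<and> a \<in> C) in (insert (C - {a}) (Q - {C}), C - {a})) \<in> ?D"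
        by (simp add: the Let_def)
    next
      fix z assume "z \<in> ?D"
      show "F (case z of (P, B) \<Rightarrow> insert (insert a B) (P - {B}))
         = (case z of (P, B) \<Rightarrow> F (insert (insert a B) (P - {B})))"
        by (simp split: prod.split)
    qed
    finally show ?thesis by simp
  qed
  finally show ?thesis .
qed

text \<open>If \<open>a\<close> joins a block with \<open>k\<close> elements, the factor \<open>(k - 1)!\<close> becomes \<open>k! = k * (k - 1)!\<close>. These
  \<open>k\<close> copies are distributed over the elements \<open>j\<close> of the block; the copy for \<open>j\<close> is the term in which
  the argument at \<open>j\<close> has been multiplied by the argument at \<open>a\<close>.\<close>

lemma cycle_sum_insert:
  fixes x :: "'a::comm_monoid_mult \<Rightarrow> 'r::comm_ring_1" and S :: "'i set"
  assumes S: "finite S" "a \<notin> S"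
  shows "cycle_sum x (insert a S) w =
    - x (w a) * cycle_sum x S w + (\<Sum>j\<in>S. cycle_sum x S (w(j := w j * w a)))"
proof -
  define b where "b w B = of_nat (fact (card B - 1)) * x (\<Prod>s\<in>B. w s)" for w and B :: "'i set"
  define t where "t w P = (-1) ^ card P * (\<Prod>B\<in>P. b w B)" for w P
  have cs: "cycle_sum x T w = (\<Sum>P | partition_on T P. t w P)" for T w
    by (simp add: cycle_sum_def t_def b_def)
  have fin: "finite P" if "partition_on S P" for P
    using S(1) that by (rule finite_elements)
  have finB: "finite B" if "partition_on S P" "B \<in> P" for P B
    using S(1) that by (auto simp: partition_on_def intro: finite_subset)
  have new: "t w (insert {a} P) = - x (w a) * t w P" if P: "partition_on S P" for P
  proof -
    have "{a} \<notin> P" using P S by (auto simp: partition_on_def)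
    then show ?thesis using fin[OF P] by (simp add: t_def b_def)
  qed
  have old: "t w (insert (insert a B) (P - {B})) = (\<Sum>j\<in>B. t (w(j := w j * w a)) P)"
    if P: "partition_on S P" and B: "B \<in> P" for P B
  proof -
    have a: "a \<notin> C" if "C \<in> P" for C
      using P that S by (auto simp: partition_on_def)
    have "B \<noteq> {}" using P B by (auto simp: partition_on_def)
    then have card: "card B > 0" using finB[OF P B] by (simp add: card_gt_0_iff)
    have "insert a B \<notin> P - {B}" using a by auto
    moreover have "card (P - {B}) = card P - 1" "card P > 0"
      using fin[OF P] B by (auto simp: card_gt_0_iff)
    ultimately have "t w (insert (insert a B) (P - {B}))
        = (-1) ^ card P * (b w (insert a B) * (\<Prod>C\<in>P - {B}. b w C))"
      using fin[OF P] by (simp add: t_def)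
    moreover have "t (w(j := w j * w a)) P =
        (-1) ^ card P * (of_nat (fact (card B - 1)) * x (\<Prod>s\<in>insert a B. w s) * (\<Prod>C\<in>P - {B}. b w C))"
      if j: "j \<in> B" for j
    proof -
      have "(\<Prod>s\<in>B. (w(j := w j * w a)) s) = (w j * w a) * (\<Prod>s\<in>B - {j}. w s)"
        using finB[OF P B] j by (subst prod.remove[OF _ j]) (auto intro!: prod.cong)
      also have "\<dots> = (\<Prod>s\<in>insert a B. w s)"
        using finB[OF P B] a[OF B] prod.remove[OF finB[OF P B] j, of w] by (simp add: ac_simps)
      finally have "b (w(j := w j * w a)) B = of_nat (fact (card B - 1)) * x (\<Prod>s\<in>insert a B. w s)"
        by (simp add: b_def)
      moreover have "b (w(j := w j * w a)) C = b w C" if "C \<in> P - {B}" for C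
      proof -
        have "j \<notin> C" using P B j that by (auto simp: partition_on_def disjoint_def)
        then have "(\<Prod>s\<in>C. (w(j := w j * w a)) s) = (\<Prod>s\<in>C. w s)"
          by (intro prod.cong) auto
        then show ?thesis by (simp add: b_def)
      qed
      then have "(\<Prod>C\<in>P - {B}. b (w(j := w j * w a)) C) = (\<Prod>C\<in>P - {B}. b w C)"
        by (rule prod.cong[OF refl])
      ultimately show ?thesis
        unfolding t_def by (subst prod.remove[OF fin[OF P] B]) simp
    qed
    moreover have "b w (insert a B)
        = of_nat (card B) * (of_nat (fact (card B - 1)) * x (\<Prod>s\<in>insert a B. w s))"
    proof -
      have "fact (card B) = card B * fact (card B - 1)"
        using card by (subst fact_reduce) auto
      then have "of_nat (fact (card B)) = (of_nat (card B) * of_nat (fact (card B - 1)) :: 'r)"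
        by (simp only: of_nat_mult)
      then show ?thesis
        using finB[OF P B] a[OF B] by (simp add: b_def mult.assoc)
    qed
    ultimately show ?thesis by (simp add: algebra_simps)
  qed
  have "cycle_sum x (insert a S) w = (\<Sum>P | partition_on S P. t w (insert {a} P))
      + (\<Sum>P | partition_on S P. \<Sum>B\<in>P. t w (insert (insert a B) (P - {B})))"
    unfolding cs by (rule sum_partitions_insert[OF S])
  also have "(\<Sum>P | partition_on S P. t w (insert {a} P)) = - x (w a) * cycle_sum x S w"
    by (simp add: cs new sum_distrib_left)
  also have "(\<Sum>P | partition_on S P. \<Sum>B\<in>P. t w (insert (insert a B) (P - {B})))
      = (\<Sum>P | partition_on S P. \<Sum>j\<in>S. t (w(j := w j * w a)) P)"
  proof (rule sum.cong[OF refl], clarify)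
    fix P assume P: "partition_on S P"
    have "(\<Sum>B\<in>P. \<Sum>j\<in>B. t (w(j := w j * w a)) P) = (\<Sum>j\<in>\<Union>P. t (w(j := w j * w a)) P)"
      using P finB[OF P]
      by (subst sum.Union_disjoint) (auto simp: partition_on_def disjoint_def)
    then show "(\<Sum>B\<in>P. t w (insert (insert a B) (P - {B}))) = (\<Sum>j\<in>S. t (w(j := w j * w a)) P)"
      using old[OF P] P by (simp add: partition_on_def)
  qed
  also have "\<dots> = (\<Sum>j\<in>S. cycle_sum x S (w(j := w j * w a)))"
    unfolding cs by (rule sum.swap)
  finally show ?thesis .
qed

text \<open>In every partition the index \<open>j\<close> lies in exactly one block, so each term contains the argument at
  \<open>j\<close> in a single value of \<open>x\<close>. Hence a cycle sum is additive or homogeneous in each argument if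
  \<open>x\<close> is.\<close>

lemma cycle_sum_slot:
  assumes S: "finite S" "j \<in> S"
  obtains u r where
    "\<And>a. cycle_sum x S (w(j := a)) = (\<Sum>P | partition_on S P. r P * x (u P * a))"
proof -
  have "\<exists>u r. \<forall>a. (-1) ^ card P * (\<Prod>B\<in>P. of_nat (fact (card B - 1)) * x (\<Prod>s\<in>B. (w(j := a)) s))
      = r * x (u * a)"
    if P: "partition_on S P" for P
  proof -
    obtain B where B: "B \<in> P" "j \<in> B" using P S(2) by (auto simp: partition_on_def)
    have "B \<subseteq> S" using P B(1) by (auto simp: partition_on_def)
    then have fin: "finite P" "finite B"
      using finite_elements[OF S(1) P] S(1) by (simp_all add: finite_subset)
    have 1: "(\<Prod>s\<in>B. (w(j := a)) s) = (\<Prod>s\<in>B - {j}. w s) * a" for a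
      using fin B(2) by (subst prod.remove[of _ j]) (auto simp: mult.commute intro!: prod.cong)
    have 2: "(\<Prod>s\<in>C. (w(j := a)) s) = (\<Prod>s\<in>C. w s)" if "C \<in> P - {B}" for C a
    proof -
      have "j \<notin> C" using P B that by (auto simp: partition_on_def disjoint_def)
      then show ?thesis by (intro prod.cong) auto
    qed
    have 3: "(\<Prod>C\<in>P - {B}. of_nat (fact (card C - 1)) * x (\<Prod>s\<in>C. (w(j := a)) s))
        = (\<Prod>C\<in>P - {B}. of_nat (fact (card C - 1)) * x (\<Prod>s\<in>C. w s))" for a
      by (intro prod.cong refl arg_cong2[where f = "(*)"] arg_cong[where f = x] 2)
    show ?thesis
      by (rule exI[of _ "\<Prod>s\<in>B - {j}. w s"],
          rule exI[of _ "(-1) ^ card P * of_nat (fact (card B - 1)) *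
            (\<Prod>C\<in>P - {B}. of_nat (fact (card C - 1)) * x (\<Prod>s\<in>C. w s))"])
        (simp only: prod.remove[OF fin(1) B(1)] 1 3 ac_simps simp_thms)
  qed
  then have "\<forall>P. \<exists>u r. partition_on S P \<longrightarrow> (\<forall>a. (-1) ^ card P *
      (\<Prod>B\<in>P. of_nat (fact (card B - 1)) * x (\<Prod>s\<in>B. (w(j := a)) s)) = r * x (u * a))"
    by blast
  then obtain u where "\<forall>P. \<exists>r. partition_on S P \<longrightarrow> (\<forall>a. (-1) ^ card P *
      (\<Prod>B\<in>P. of_nat (fact (card B - 1)) * x (\<Prod>s\<in>B. (w(j := a)) s)) = r * x (u P * a))"
    by (rule choice[THEN exE])
  then obtain r where "\<forall>P. partition_on S P \<longrightarrow> (\<forall>a. (-1) ^ card P *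
      (\<Prod>B\<in>P. of_nat (fact (card B - 1)) * x (\<Prod>s\<in>B. (w(j := a)) s)) = r P * x (u P * a))"
    by (rule choice[THEN exE])
  then show ?thesis by (intro that[of r u]) (simp add: cycle_sum_def del: fun_upd_apply)
qed

lemma card_partition_less:
  assumes S: "finite S" and P: "partition_on S P" and ne: "P \<noteq> (\<lambda>s. {s}) ` S"
  shows "card P < card S"
proof -
  have fin: "finite B" "card B > 0" if "B \<in> P" for B
    using S P that by (auto simp: partition_on_def card_gt_0_iff intro: finite_subset)
  have "\<exists>B\<in>P. card B \<noteq> 1"
  proof (rule ccontr)
    assume "\<not> ?thesis"
    then have one: "\<exists>s. B = {s}" if "B \<in> P" for B using that card_1_singletonE by blast
    have "P = (\<lambda>s. {s}) ` S"
    proof (intro equalityI subsetI)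
      fix B assume "B \<in> P"
      then obtain s where "B = {s}" using one by blast
      then show "B \<in> (\<lambda>s. {s}) ` S" using P \<open>B \<in> P\<close> by (auto simp: partition_on_def)
    next
      fix B assume "B \<in> (\<lambda>s. {s}) ` S"
      then obtain s C where "B = {s}" "s \<in> C" "C \<in> P" using P by (auto simp: partition_on_def)
      then show "B \<in> P" using one[of C] by auto
    qed
    with ne show False by simp
  qed
  then have "(\<Sum>B\<in>P. 1) < (\<Sum>B\<in>P. card B)"
  proof (intro sum_strict_mono_ex1 ballI)
    show "finite P" by (rule finite_elements[OF S P])
    show "1 \<le> card B" if "B \<in> P" for B using fin(2)[OF that] by simp
    show "\<exists>B\<in>P. 1 < card B"
      using \<open>\<exists>B\<in>P. card B \<noteq> 1\<close> fin(2) by (metis One_nat_def less_one nat_neq_iff)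
  qed
  also have "\<dots> = card S"
    using product_partition[OF P] fin by simp
  finally show ?thesis by simp
qed

text \<open>The finest partition gives the product of all \<open>x (w s)\<close>; by \<open>card_partition_less\<close> the remaining
  terms are products of fewer values of \<open>x\<close>, which is what an induction on the number of factors
  needs.\<close>

lemma cycle_sum_leading:
  assumes S: "finite S"
  shows "cycle_sum x S w = (-1) ^ card S * (\<Prod>s\<in>S. x (w s)) +
    (\<Sum>P | partition_on S P \<and> P \<noteq> (\<lambda>s. {s}) ` S.
        (-1) ^ card P * (\<Prod>B\<in>P. of_nat (fact (card B - 1)) * x (\<Prod>s\<in>B. w s)))"
proof -
  let ?P = "(\<lambda>s. {s}) ` S"
  have inj: "inj_on (\<lambda>s. {s}) S" by (simp add: inj_on_def)
  have "{P. partition_on S P} - {?P} = {P. partition_on S P \<and> P \<noteq> ?P}" by auto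
  moreover have "?P \<in> {P. partition_on S P}" by (simp add: partition_on_singletons)
  ultimately show ?thesis
    unfolding cycle_sum_def
    by (simp add: sum.remove[OF finitely_many_partition_on[OF S], of ?P] card_image[OF inj]
        prod.reindex[OF inj])
qed

section \<open>Formal tensors\<close>

lemma keys_sum_single:
  assumes "\<And>k. h k 0 = 0"
  shows "(\<Sum>j\<in>Poly_Mapping.keys (Poly_Mapping.single k c). h j (Poly_Mapping.lookup (Poly_Mapping.single k c) j)) = h k c"
  by (cases "c = 0") (simp_all add: assms)

lemma poly_mapping_sum_single:
  fixes f :: "'a \<Rightarrow>\<^sub>0 'b::comm_monoid_add"
  shows "f = (\<Sum>k\<in>Poly_Mapping.keys f. Poly_Mapping.single k (Poly_Mapping.lookup f k))"
  by (rule poly_mapping_eqI) (auto simp: lookup_sum lookup_single when_def in_keys_iff)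

lemma poly_mapping_additive_induct [consumes 1, case_names zero single add]:
  fixes f :: "'a \<Rightarrow>\<^sub>0 'b::comm_monoid_add"
  assumes "Poly_Mapping.keys f \<subseteq> X" "Q 0"
    and "\<And>k c. k \<in> X \<Longrightarrow> Q (Poly_Mapping.single k c)"
    and "\<And>f g. Q f \<Longrightarrow> Q g \<Longrightarrow> Q (f + g)"
  shows "Q f"
proof -
  have "Q (\<Sum>k\<in>Y. Poly_Mapping.single k (Poly_Mapping.lookup f k))"
    if "finite Y" "Y \<subseteq> X" for Y
    using that assms(2-4) by (induction Y rule: finite_induct) auto
  then have "Q (\<Sum>k\<in>Poly_Mapping.keys f. Poly_Mapping.single k (Poly_Mapping.lookup f k))"
    using assms(1) by simp
  then show ?thesis by (simp add: poly_mapping_sum_single[symmetric])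
qed

lemma lookup_formal_scale [simp]:
  "Poly_Mapping.lookup (formal_scale c f) k = c * Poly_Mapping.lookup f k"
  by (simp add: formal_scale_def Poly_Mapping.map.rep_eq when_def)

lemma keys_formal_scale: "Poly_Mapping.keys (formal_scale c f) \<subseteq> Poly_Mapping.keys f"
  by (auto simp: in_keys_iff)

lemma formal_scale_single:
  "formal_scale c (Poly_Mapping.single k d) = Poly_Mapping.single k (c * d)"
  by (rule poly_mapping_eqI) (simp add: lookup_single when_def)

interpretation formal: vector_space "formal_scale :: 'k::field \<Rightarrow> ('a, 'k) formal_tensor \<Rightarrow> _"
  by unfold_locales
    (auto intro!: poly_mapping_eqI simp: lookup_add algebra_simps)

lemma formal_mult_add_left: "formal_mult (f + g) h = formal_mult f h + formal_mult g h"
proof -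
  define H where "H xs c = (\<Sum>ys\<in>Poly_Mapping.keys h.
      Poly_Mapping.single (map2 (*) xs ys) (c * Poly_Mapping.lookup h ys))" for xs c
  have "formal_mult f h = (\<Sum>xs\<in>Poly_Mapping.keys f. H xs (Poly_Mapping.lookup f xs))" for f
    by (simp add: formal_mult_def H_def)
  moreover have "H xs 0 = 0" "H xs (c + d) = H xs c + H xs d" for xs c d
    by (simp_all add: H_def single_add distrib_right sum.distrib)
  ultimately show ?thesis by (simp add: setsum_keys_plus_distrib)
qed

lemma formal_mult_commute: "formal_mult f g = formal_mult g f"
proof -
  have "Poly_Mapping.single (map2 (*) xs ys) (a * b) = Poly_Mapping.single (map2 (*) ys xs) (b * a)"
    for xs ys :: "'a list" and a b :: 'b
  proof -
    have "map2 (*) xs ys = map2 (*) ys xs"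
      by (rule nth_equalityI) (auto simp: mult.commute)
    then show ?thesis by (simp add: mult.commute)
  qed
  then show ?thesis
    unfolding formal_mult_def by (subst sum.swap) (intro sum.cong refl)
qed

lemma formal_mult_add_right: "formal_mult f (g + h) = formal_mult f g + formal_mult f h"
  by (simp add: formal_mult_commute[of f] formal_mult_add_left)

lemma formal_mult_single:
  "formal_mult (Poly_Mapping.single xs a) (Poly_Mapping.single ys b) =
    Poly_Mapping.single (map2 (*) xs ys) (a * b)"
proof (cases "a = 0 \<or> b = 0")
  case True
  then show ?thesis by (auto simp: formal_mult_def)
next
  case False
  then show ?thesis by (simp add: formal_mult_def)
qed

lemma formal_mult_pure: "formal_mult (formal_pure xs) (formal_pure ys) = formal_pure (map2 (*) xs ys)"
  by (simp add: formal_pure_def formal_mult_single)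

lemma formal_mult_zero [simp]: "formal_mult 0 f = 0" "formal_mult f 0 = 0"
  by (simp_all add: formal_mult_def)

lemma formal_mult_minus_left: "formal_mult (- f) g = - formal_mult f g"
  using formal_mult_add_left[of f "- f" g] by (simp add: eq_neg_iff_add_eq_0 add.commute)

lemma formal_mult_diff_left: "formal_mult (f - g) h = formal_mult f h - formal_mult g h"
  using formal_mult_add_left[of f "- g" h] by (simp add: formal_mult_minus_left)

lemma formal_mult_sum_left: "formal_mult (\<Sum>i\<in>I. f i) g = (\<Sum>i\<in>I. formal_mult (f i) g)"
  by (induction I rule: infinite_finite_induct) (simp_all add: formal_mult_add_left)

lemma formal_mult_sum_right: "formal_mult g (\<Sum>i\<in>I. f i) = (\<Sum>i\<in>I. formal_mult g (f i))"
  by (simp add: formal_mult_commute[of g] formal_mult_sum_left)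

lemma formal_mult_scale_left: "formal_mult (formal_scale c f) g = formal_scale c (formal_mult f g)"
proof -
  have "Poly_Mapping.keys f \<subseteq> UNIV" by simp
  then show ?thesis
  proof (induction rule: poly_mapping_additive_induct)
    case (single xs d)
    have "Poly_Mapping.keys g \<subseteq> UNIV" by simp
    then show ?case
      by (induction rule: poly_mapping_additive_induct)
        (simp_all add: formal_scale_single formal_mult_single formal_mult_add_right
          formal.scale_right_distrib mult.assoc)
  qed (simp_all add: formal_mult_add_left formal.scale_right_distrib)
qed

lemma formal_mult_scale_right: "formal_mult f (formal_scale c g) = formal_scale c (formal_mult f g)"
  by (simp add: formal_mult_commute[of f] formal_mult_scale_left)

lemma map2_list_update_left:
  assumes "length xs = length ys" "i < length xs"
  shows "map2 (*) (xs[i := x]) ys = (map2 (*) xs ys)[i := x * ys ! i]"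
  using assms by (intro nth_equalityI) (auto simp: nth_list_update)

lemma carrier_formal_tensors:
  "f \<in> carrier (formal_tensors n) \<longleftrightarrow> Poly_Mapping.keys f \<subseteq> {xs. length xs = n}"
  by (auto simp: formal_tensors_def)

lemma subspace_formal_tensors:
  "formal.subspace (carrier (formal_tensors n :: ('a::comm_ring_1, 'k::field) formal_tensor ring))"
proof (rule formal.subspaceI)
  fix f g :: "('a, 'k) formal_tensor" and c :: 'k
  assume f: "f \<in> carrier (formal_tensors n)"
  show "formal_scale c f \<in> carrier (formal_tensors n)"
    using f keys_formal_scale[of c f] unfolding carrier_formal_tensors by (rule order_trans[rotated])
  assume "g \<in> carrier (formal_tensors n)"
  then have "Poly_Mapping.keys f \<union> Poly_Mapping.keys g \<subseteq> {xs. length xs = n}"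
    using f by (simp add: carrier_formal_tensors)
  with keys_add[of f g] show "f + g \<in> carrier (formal_tensors n)"
    unfolding carrier_formal_tensors by (rule order_trans)
qed (simp add: carrier_formal_tensors)

lemmas formal_tensors_closed =
  formal.subspace_0[OF subspace_formal_tensors] formal.subspace_add[OF subspace_formal_tensors]
  formal.subspace_diff[OF subspace_formal_tensors] formal.subspace_scale[OF subspace_formal_tensors]
  formal.subspace_sum[OF subspace_formal_tensors] formal.subspace_neg[OF subspace_formal_tensors]

lemma single_in_formal_tensors:
  "length xs = n \<Longrightarrow> Poly_Mapping.single xs c \<in> carrier (formal_tensors n)"
  by (simp add: carrier_formal_tensors)

lemma formal_pure_in_formal_tensors:
  "length xs = n \<Longrightarrow> formal_pure xs \<in> carrier (formal_tensors n)"
  by (simp add: formal_pure_def single_in_formal_tensors)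

lemma formal_tensors_induct [consumes 1, case_names zero single add]:
  assumes "f \<in> carrier (formal_tensors n)" "Q 0"
    and "\<And>xs c. length xs = n \<Longrightarrow> Q (Poly_Mapping.single xs c)"
    and "\<And>f g. Q f \<Longrightarrow> Q g \<Longrightarrow> Q (f + g)"
  shows "Q f"
  using assms(1) unfolding carrier_formal_tensors
  by (rule poly_mapping_additive_induct) (use assms in auto)

lemma formal_mult_closed:
  assumes "f \<in> carrier (formal_tensors n)" "g \<in> carrier (formal_tensors n)"
  shows "formal_mult f g \<in> carrier (formal_tensors n)"
  using assms(1)
proof (induction rule: formal_tensors_induct)
  case (single xs c)
  from assms(2) show ?case
    by (induction rule: formal_tensors_induct)
      (use single in \<open>simp_all add: formal_mult_single formal_mult_add_right formal_tensors_closed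
        single_in_formal_tensors\<close>)
qed (simp_all add: formal_mult_add_left formal_tensors_closed)


section \<open>Tensor powers\<close>

locale tensor_algebra = commutative_algebra scale
  for scale :: "'k::field \<Rightarrow> 'a::comm_ring_1 \<Rightarrow> 'a" +
  fixes n :: nat
begin

abbreviation null where "null \<equiv> null_tensors scale n"
abbreviation cls where "cls \<equiv> tensor_class scale n"
abbreviation tensors :: "('a, 'k) formal_tensor set" where "tensors \<equiv> carrier (formal_tensors n)"

lemmas null_closed =
  formal.span_zero[of "multilinearity_relations scale n", folded null_tensors_def]
  formal.span_add[of _ "multilinearity_relations scale n", folded null_tensors_def]
  formal.span_diff[of _ "multilinearity_relations scale n", folded null_tensors_def]
  formal.span_neg[of _ "multilinearity_relations scale n", folded null_tensors_def]
  formal.span_scale[of _ "multilinearity_relations scale n", folded null_tensors_def]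
  formal.span_sum[of _ _ "multilinearity_relations scale n", folded null_tensors_def]

lemma null_induct [consumes 1, case_names subspace add scale]:
  assumes "f \<in> null" and sub: "formal.subspace {f. Q f}"
    and "\<And>xs i x y. length xs = n \<Longrightarrow> i < n \<Longrightarrow>
      Q (formal_pure (xs[i := x + y]) - formal_pure (xs[i := x]) - formal_pure (xs[i := y]))"
    and "\<And>xs i c x. length xs = n \<Longrightarrow> i < n \<Longrightarrow>
      Q (formal_pure (xs[i := scale c x]) - formal_scale c (formal_pure (xs[i := x])))"
  shows "Q f"
  using assms(1) unfolding null_tensors_def
  by (rule formal.span_induct[OF _ sub])
    (use assms(3,4) in \<open>auto simp: multilinearity_relations_def\<close>)

lemma null_pure_add:
  "length xs = n \<Longrightarrow> i < n \<Longrightarrow>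
    formal_pure (xs[i := x + y]) - formal_pure (xs[i := x]) - formal_pure (xs[i := y]) \<in> null"
  unfolding null_tensors_def multilinearity_relations_def by (intro formal.span_base) blast

lemma null_pure_scale:
  "length xs = n \<Longrightarrow> i < n \<Longrightarrow>
    formal_pure (xs[i := scale c x]) - formal_scale c (formal_pure (xs[i := x])) \<in> null"
  unfolding null_tensors_def multilinearity_relations_def by (intro formal.span_base) blast

lemma null_subset_tensors: "null \<subseteq> tensors"
proof
  fix f assume "f \<in> null"
  then show "f \<in> tensors"
    by (induction rule: null_induct)
      (simp_all add: subspace_formal_tensors formal_tensors_closed formal_pure_in_formal_tensors)
qed

text \<open>Multiplying a relation in slot \<open>i\<close> by a pure tensor gives a relation in the same slot, because the
  multiplication of \<open>A\<close> is bilinear. This makes the product of the tensor power well defined.\<close>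

lemma null_mult:
  assumes "f \<in> null" "g \<in> tensors"
  shows "formal_mult f g \<in> null"
  using assms(1)
proof (induction rule: null_induct)
  case subspace
  show ?case
    by (rule formal.subspaceI)
      (simp_all add: formal_mult_add_left formal_mult_scale_left null_closed)
next
  case (add xs i x y)
  from assms(2) show ?case
  proof (induction rule: formal_tensors_induct)
    case (single ys c)
    have "map2 (*) (xs[i := z]) ys = (map2 (*) xs ys)[i := z * ys ! i]" for z
      using add single by (simp add: map2_list_update_left)
    then have eq: "formal_mult (formal_pure (xs[i := z])) (Poly_Mapping.single ys c) =
        formal_scale c (formal_pure ((map2 (*) xs ys)[i := z * ys ! i]))" for z
      by (simp add: formal_pure_def formal_mult_single formal_scale_single)
    show ?case
      using null_closed(5)[OF null_pure_add[of "map2 (*) xs ys" i "x * ys ! i" "y * ys ! i"], of c]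
        add single
      by (simp add: formal_mult_diff_left eq distrib_right formal.scale_right_diff_distrib)
  qed (simp_all add: formal_mult_add_right null_closed)
next
  case (scale xs i c x)
  from assms(2) show ?case
  proof (induction rule: formal_tensors_induct)
    case (single ys d)
    have "map2 (*) (xs[i := z]) ys = (map2 (*) xs ys)[i := z * ys ! i]" for z
      using scale single by (simp add: map2_list_update_left)
    then have eq: "formal_mult (formal_pure (xs[i := z])) (Poly_Mapping.single ys d) =
        formal_scale d (formal_pure ((map2 (*) xs ys)[i := z * ys ! i]))" for z
      by (simp add: formal_pure_def formal_mult_single formal_scale_single)
    show ?case
      using null_closed(5)[OF null_pure_scale[of "map2 (*) xs ys" i c "x * ys ! i"], of d]
        scale single
      by (simp add: formal_mult_diff_left formal_mult_scale_left eq scale_mult_left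
          formal.scale_right_diff_distrib mult.commute[of c d])
  qed (simp_all add: formal_mult_add_right null_closed)
qed

lemma cls_image: "cls f = (\<lambda>h. h + f) ` null"
  unfolding tensor_class_def a_r_coset_def' by (auto simp: formal_tensors_def)

lemma mem_cls_iff: "g \<in> cls f \<longleftrightarrow> g - f \<in> null"
  by (auto simp: cls_image image_iff intro: bexI[of _ "g - f"])

lemma cls_self: "f \<in> cls f"
  by (simp add: mem_cls_iff null_closed)

lemma cls_eq_iff: "cls f = cls g \<longleftrightarrow> f - g \<in> null"
proof
  assume "cls f = cls g"
  then show "f - g \<in> null" using cls_self[of f] by (simp add: mem_cls_iff)
next
  assume fg: "f - g \<in> null"
  have "h - f \<in> null \<longleftrightarrow> h - g \<in> null" for h
    using null_closed(2)[OF _ fg, of "h - f"] null_closed(3)[OF _ fg, of "h - g"] by auto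
  then show "cls f = cls g" by (auto simp: mem_cls_iff)
qed

lemma cls_add: "cls f \<oplus>\<^bsub>tensor_power scale n\<^esub> cls g = cls (f + g)"
proof -
  have "cls f <+>\<^bsub>formal_tensors n\<^esub> cls g = cls (f + g)"
  proof (intro equalityI subsetI)
    fix h assume "h \<in> cls f <+>\<^bsub>formal_tensors n\<^esub> cls g"
    then obtain a b where ab: "a - f \<in> null" "b - g \<in> null" "h = a + b"
      by (auto simp: set_add_def' mem_cls_iff formal_tensors_def)
    have "h - (f + g) = (a - f) + (b - g)" using ab by simp
    then show "h \<in> cls (f + g)" using null_closed(2)[OF ab(1,2)] by (simp only: mem_cls_iff)
  next
    fix h assume "h \<in> cls (f + g)"
    then have "h - g \<in> cls f" by (simp add: mem_cls_iff algebra_simps)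
    then have "(h - g) + g \<in> cls f <+>\<^bsub>formal_tensors n\<^esub> cls g"
      using cls_self[of g] by (force simp: set_add_def' formal_tensors_def)
    then show "h \<in> cls f <+>\<^bsub>formal_tensors n\<^esub> cls g" by simp
  qed
  then show ?thesis by (simp add: tensor_power_def FactRing_def Let_def)
qed

lemma cls_mult:
  assumes "f \<in> tensors" "g \<in> tensors"
  shows "cls f \<otimes>\<^bsub>tensor_power scale n\<^esub> cls g = cls (formal_mult f g)"
proof -
  have eq: "cls (formal_mult a b) = cls (formal_mult f g)" if a: "a \<in> cls f" and b: "b \<in> cls g" for a b
  proof -
    have "b - g \<in> tensors" using b null_subset_tensors by (auto simp: mem_cls_iff)
    from formal_tensors_closed(2)[OF this assms(2)] have "b \<in> tensors" by simp
    then have "formal_mult (a - f) b + formal_mult (b - g) f \<in> null"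
      using a b assms by (intro null_closed(2) null_mult) (simp_all add: mem_cls_iff)
    moreover have "formal_mult (a - f) b + formal_mult (b - g) f = formal_mult a b - formal_mult f g"
      by (simp add: formal_mult_diff_left formal_mult_commute[of b f] formal_mult_commute[of g f])
    ultimately show ?thesis by (simp add: cls_eq_iff)
  qed
  have "rcoset_mult (formal_tensors n) null (cls f) (cls g) = (\<Union>a\<in>cls f. \<Union>b\<in>cls g. cls (formal_mult a b))"
    by (simp add: rcoset_mult_def tensor_class_def formal_tensors_def)
  also have "\<dots> = (\<Union>a\<in>cls f. \<Union>b\<in>cls g. cls (formal_mult f g))"
    by (intro SUP_cong refl eq)
  also have "\<dots> = cls (formal_mult f g)"
    using cls_self[of f] cls_self[of g] by (auto simp: UN_constant)
  finally show ?thesis by (simp add: tensor_power_def FactRing_def Let_def)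
qed

lemma cls_smult: "c \<odot>\<^bsub>tensor_power scale n\<^esub> cls f = cls (formal_scale c f)"
proof -
  have "cls (formal_scale c g) = cls (formal_scale c f)" if "g \<in> cls f" for g
    using null_closed(5)[of "g - f" c] that
    by (simp add: cls_eq_iff mem_cls_iff formal.scale_right_diff_distrib)
  then have "(\<Union>g\<in>cls f. cls (formal_scale c g)) = (\<Union>g\<in>cls f. cls (formal_scale c f))"
    by (intro SUP_cong refl)
  also have "\<dots> = cls (formal_scale c f)"
    using cls_self[of f] by (auto simp: UN_constant)
  finally show ?thesis by (simp add: tensor_power_def Let_def)
qed

lemma tensor_power_zero: "\<zero>\<^bsub>tensor_power scale n\<^esub> = cls 0"
  by (simp add: tensor_power_def FactRing_def Let_def cls_image)

lemma tensor_power_one: "\<one>\<^bsub>tensor_power scale n\<^esub> = cls (formal_pure (replicate n 1))"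
  by (simp add: tensor_power_def FactRing_def Let_def tensor_class_def formal_tensors_def)

lemma carrier_tensor_power: "carrier (tensor_power scale n) = cls ` tensors"
  by (auto simp: tensor_power_def FactRing_def Let_def tensor_class_def A_RCOSETS_def')

lemma tensor_power_finsum:
  assumes "finite I" "\<And>i. i \<in> I \<Longrightarrow> f i \<in> tensors"
  shows "(\<Oplus>\<^bsub>tensor_power scale n\<^esub>i\<in>I. cls (f i)) = cls (\<Sum>i\<in>I. f i)"
proof -
  interpret abelian_monoid "tensor_power scale n"
    by (rule abelian_monoidI)
      (auto simp: carrier_tensor_power tensor_power_zero cls_add formal_tensors_closed ac_simps)
  show ?thesis
    using assms
  proof (induction I rule: finite_induct)
    case empty
    then show ?case by (simp add: tensor_power_zero)
  next
    case (insert i I)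
    have "(\<lambda>i. cls (f i)) \<in> I \<rightarrow> carrier (tensor_power scale n)"
      using insert.prems by (auto simp: carrier_tensor_power)
    moreover have "cls (f i) \<in> carrier (tensor_power scale n)"
      using insert.prems by (auto simp: carrier_tensor_power)
    ultimately show ?case using insert by (simp add: finsum_insert cls_add)
  qed
qed

end

section \<open>Sums over injections\<close>

definition formal_bracket :: "nat \<Rightarrow> 'a \<Rightarrow> ('a::comm_ring_1, 'k::field) formal_tensor" where
  "formal_bracket n a = (\<Sum>i<n. formal_pure ((replicate n 1)[i := a]))"

text \<open>For injective \<open>g\<close> the list has \<open>w s\<close> in slot \<open>g s\<close> and \<open>1\<close> in all slots outside the image of \<open>g\<close>.
  Slots are filled with products so that \<open>slot_products_absorb\<close> can be compared with
  \<open>slot_products_insert\<close>: a second factor in an occupied slot multiplies the one already there.\<close>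

definition slot_products :: "nat \<Rightarrow> 'i set \<Rightarrow> ('i \<Rightarrow> 'a::comm_ring_1) \<Rightarrow> ('i \<Rightarrow> nat) \<Rightarrow> 'a list" where
  "slot_products n S w g = map (\<lambda>i. \<Prod>s\<in>{s\<in>S. g s = i}. w s) [0..<n]"

definition injections :: "nat \<Rightarrow> 'i set \<Rightarrow> ('i \<Rightarrow> nat) set" where
  "injections n S = {g \<in> S \<rightarrow>\<^sub>E {..<n}. inj_on g S}"

definition injection_sum ::
    "nat \<Rightarrow> 'i set \<Rightarrow> ('i \<Rightarrow> 'a::comm_ring_1) \<Rightarrow> ('a, 'k::field) formal_tensor" where
  "injection_sum n S w = (\<Sum>g\<in>injections n S. formal_pure (slot_products n S w g))"

lemma finite_injections: "finite S \<Longrightarrow> finite (injections n S)"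
  unfolding injections_def by (rule finite_subset[OF _ finite_PiE[of S "\<lambda>_. {..<n}"]]) auto

lemma length_slot_products [simp]: "length (slot_products n S w g) = n"
  by (simp add: slot_products_def)

lemma formal_bracket_closed: "formal_bracket n a \<in> carrier (formal_tensors n)"
  unfolding formal_bracket_def
  by (intro formal_tensors_closed formal_pure_in_formal_tensors) simp

lemma injection_sum_empty: "injection_sum n {} w = formal_pure (replicate n 1)"
  by (simp add: injection_sum_def injections_def slot_products_def map_replicate_trivial)

lemma injection_sum_too_many:
  assumes "finite S" "card S > n"
  shows "injection_sum n S w = 0"
proof -
  have "injections n S = {}"
  proof (rule equals0I)
    fix g assume "g \<in> injections n S"
    then have "inj_on g S" "g ` S \<subseteq> {..<n}" by (auto simp: injections_def)
    then have "card S \<le> card {..<n}" by (intro card_inj_on_le) auto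
    with assms show False by simp
  qed
  then show ?thesis by (simp add: injection_sum_def)
qed

lemma slot_products_insert:
  assumes "finite S" "a \<notin> S"
  shows "slot_products n (insert a S) w (g(a := i)) =
    map2 (*) ((replicate n 1)[i := w a]) (slot_products n S w g)"
proof (rule nth_equalityI)
  fix k assume "k < length (slot_products n (insert a S) w (g(a := i)))"
  then have k: "k < n" by simp
  have "{s \<in> insert a S. (g(a := i)) s = k} = (if k = i then insert a {s \<in> S. g s = k} else {s \<in> S. g s = k})"
    using assms(2) by auto
  then show "slot_products n (insert a S) w (g(a := i)) ! k =
      map2 (*) ((replicate n 1)[i := w a]) (slot_products n S w g) ! k"
    using k assms by (simp add: slot_products_def nth_list_update)
qed simp

lemma slot_products_absorb:
  assumes "finite S" "j \<in> S"
  shows "slot_products n S (w(j := w j * b)) g =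
    map2 (*) ((replicate n 1)[g j := b]) (slot_products n S w g)"
proof (rule nth_equalityI)
  fix k assume "k < length (slot_products n S (w(j := w j * b)) g)"
  then have k: "k < n" by simp
  have "(\<Prod>s\<in>{s \<in> S. g s = k}. (w(j := w j * b)) s) =
      (if k = g j then b else 1) * (\<Prod>s\<in>{s \<in> S. g s = k}. w s)"
  proof (cases "k = g j")
    case True
    have fin: "finite {s \<in> S. g s = k}" "j \<in> {s \<in> S. g s = k}" using assms True by auto
    have "(\<Prod>s\<in>{s \<in> S. g s = k} - {j}. (w(j := w j * b)) s) = (\<Prod>s\<in>{s \<in> S. g s = k} - {j}. w s)"
      by (intro prod.cong) auto
    then show ?thesis
      using True prod.remove[OF fin, of "w(j := w j * b)"] prod.remove[OF fin, of w]
      by (simp add: mult_ac del: fun_upd_apply) simp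
  next
    case False
    then show ?thesis by (auto intro!: prod.cong)
  qed
  then show "slot_products n S (w(j := w j * b)) g ! k =
      map2 (*) ((replicate n 1)[g j := b]) (slot_products n S w g) ! k"
    using k by (simp add: slot_products_def nth_list_update del: fun_upd_apply)
qed simp

lemma sum_injections_insert:
  assumes S: "finite S" "a \<notin> S"
  shows "(\<Sum>h\<in>injections n (insert a S). F h) =
    (\<Sum>g\<in>injections n S. \<Sum>i\<in>{..<n} - g ` S. F (g(a := i)))"
proof -
  have "(\<Sum>g\<in>injections n S. \<Sum>i\<in>{..<n} - g ` S. F (g(a := i))) =
      (\<Sum>(g, i)\<in>(SIGMA g:injections n S. {..<n} - g ` S). F (g(a := i)))"
    using S(1) by (subst sum.Sigma) (auto simp: finite_injections)
  also have "\<dots> = (\<Sum>h\<in>injections n (insert a S). F h)"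
  proof (rule sum.reindex_bij_witness[where i = "\<lambda>h. (h(a := undefined), h a)" and
        j = "\<lambda>(g, i). g(a := i)"])
    fix z assume "z \<in> (SIGMA g:injections n S. {..<n} - g ` S)"
    then obtain g i where z: "z = (g, i)" and g: "g \<in> S \<rightarrow>\<^sub>E {..<n}" "inj_on g S"
      and i: "i < n" "i \<notin> g ` S"
      by (auto simp: injections_def)
    have "g a = undefined" using g(1) S(2) by (rule PiE_arb)
    then show "((case z of (g, i) \<Rightarrow> g(a := i))(a := undefined), (case z of (g, i) \<Rightarrow> g(a := i)) a) = z"
      by (simp add: z fun_upd_idem)
    have "g(a := i) \<in> insert a S \<rightarrow>\<^sub>E {..<n}"
      using g(1) i(1) by (auto simp: PiE_def extensional_def)
    moreover have "inj_on (g(a := i)) (insert a S)"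
      using g(2) i(2) S(2) by (auto simp: inj_on_def image_iff)
    ultimately show "(case z of (g, i) \<Rightarrow> g(a := i)) \<in> injections n (insert a S)"
      by (simp add: z injections_def)
    show "F (case z of (g, i) \<Rightarrow> g(a := i)) = (case z of (g, i) \<Rightarrow> F (g(a := i)))"
      by (simp add: z)
  next
    fix h assume "h \<in> injections n (insert a S)"
    then have h: "h \<in> insert a S \<rightarrow>\<^sub>E {..<n}" "inj_on h (insert a S)"
      by (auto simp: injections_def)
    show "(case (h(a := undefined), h a) of (g, i) \<Rightarrow> g(a := i)) = h" by simp
    have "h(a := undefined) \<in> S \<rightarrow>\<^sub>E {..<n}"
      using h(1) S(2) by (auto simp: PiE_def extensional_def)
    moreover have "inj_on (h(a := undefined)) S"
      using h(2) S(2) by (auto simp: inj_on_def)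
    moreover have "h a \<in> {..<n} - (h(a := undefined)) ` S"
      using h S(2) by (auto simp: inj_on_def)
    ultimately show "(h(a := undefined), h a) \<in> (SIGMA g:injections n S. {..<n} - g ` S)"
      by (simp add: injections_def)
  qed
  finally show ?thesis by simp
qed

text \<open>The same recursion as \<open>cycle_sum_insert\<close>, up to sign. The product with the bracket lets \<open>w a\<close> run
  through all slots; the free slots give the injections on \<open>insert a S\<close>, and the slot occupied by
  \<open>j\<close> gives the tensor in which \<open>w a\<close> has been absorbed into \<open>w j\<close>.\<close>

lemma injection_sum_insert:
  assumes S: "finite S" "a \<notin> S"
  shows "injection_sum n (insert a S) w =
    formal_mult (formal_bracket n (w a)) (injection_sum n S w) -
    (\<Sum>j\<in>S. injection_sum n S (w(j := w j * w a)))"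
proof -
  define F where "F g i = (formal_pure (map2 (*) ((replicate n 1)[i := w a]) (slot_products n S w g))
    :: ('b, 'c) formal_tensor)" for g i
  have "injection_sum n (insert a S) w = (\<Sum>g\<in>injections n S. \<Sum>i\<in>{..<n} - g ` S. F g i)"
    by (simp add: injection_sum_def sum_injections_insert[OF S] slot_products_insert[OF S] F_def)
  also have "\<dots> = (\<Sum>g\<in>injections n S. (\<Sum>i<n. F g i) - (\<Sum>j\<in>S. F g (g j)))"
  proof (rule sum.cong[OF refl])
    fix g assume "g \<in> injections n S"
    then have g: "g ` S \<subseteq> {..<n}" "inj_on g S" by (auto simp: injections_def)
    then show "(\<Sum>i\<in>{..<n} - g ` S. F g i) = (\<Sum>i<n. F g i) - (\<Sum>j\<in>S. F g (g j))"
      by (simp add: sum_diff sum.reindex)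
  qed
  also have "\<dots> = (\<Sum>g\<in>injections n S. \<Sum>i<n. F g i) - (\<Sum>j\<in>S. \<Sum>g\<in>injections n S. F g (g j))"
    by (simp add: sum_subtractf sum.swap[of _ S])
  also have "(\<Sum>g\<in>injections n S. \<Sum>i<n. F g i) =
      formal_mult (formal_bracket n (w a)) (injection_sum n S w)"
    by (simp add: injection_sum_def formal_bracket_def formal_mult_sum_left formal_mult_sum_right
        formal_mult_pure F_def sum.swap[of _ "{..<n}"])
  also have "(\<Sum>j\<in>S. \<Sum>g\<in>injections n S. F g (g j)) = (\<Sum>j\<in>S. injection_sum n S (w(j := w j * w a)))"
    by (simp add: injection_sum_def slot_products_absorb[OF S(1)] F_def)
  finally show ?thesis .
qed

lemma permute_formal_add: "permute_formal \<sigma> (f + g) = permute_formal \<sigma> f + permute_formal \<sigma> g"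
  unfolding permute_formal_def by (rule setsum_keys_plus_distrib) (simp_all add: single_add)

lemma permute_formal_single:
  "permute_formal \<sigma> (Poly_Mapping.single xs c) = Poly_Mapping.single (permute_list \<sigma> xs) c"
  unfolding permute_formal_def by (rule keys_sum_single) simp

lemma permute_formal_zero [simp]: "permute_formal \<sigma> 0 = 0"
  by (simp add: permute_formal_def)

text \<open>There is no division by \<open>n!\<close>, so on symmetric tensors this is multiplication by \<open>n!\<close>,
  modulo the multilinearity relations.\<close>

definition symmetrization :: "nat \<Rightarrow> ('a, 'k::field) formal_tensor \<Rightarrow> ('a, 'k) formal_tensor" where
  "symmetrization n f = (\<Sum>\<sigma> | \<sigma> permutes {..<n}. permute_formal \<sigma> f)"

lemma symmetrization_add: "symmetrization n (f + g) = symmetrization n f + symmetrization n g"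
  by (simp add: symmetrization_def permute_formal_add sum.distrib)

lemma symmetrization_zero [simp]: "symmetrization n 0 = 0"
  by (simp add: symmetrization_def)

lemma injection_extends_permutes:
  assumes "g \<in> injections n {..<n}"
  shows "(\<lambda>i. if i < n then g i else i) permutes {..<n}"
proof (rule bij_imp_permutes)
  have g: "g \<in> {..<n} \<rightarrow>\<^sub>E {..<n}" "inj_on g {..<n}" using assms by (auto simp: injections_def)
  have "bij_betw g {..<n} {..<n}"
    using g by (intro bij_betw_imageI endo_inj_surj) auto
  then show "bij_betw (\<lambda>i. if i < n then g i else i) {..<n} {..<n}"
    by (rule bij_betw_cong[THEN iffD1, rotated]) simp
qed simp

lemma permutes_reindex_injections:
  "(\<Sum>g\<in>injections n {..<n}. F (\<lambda>i. if i < n then g i else i)) = (\<Sum>\<sigma> | \<sigma> permutes {..<n}. F \<sigma>)"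
proof (rule sum.reindex_bij_witness[where
      i = "\<lambda>\<sigma>. restrict \<sigma> {..<n}" and j = "\<lambda>g i. if i < n then g i else i"])
  fix g assume "g \<in> injections n {..<n}"
  then have g: "g \<in> {..<n} \<rightarrow>\<^sub>E {..<n}" by (auto simp: injections_def)
  show "restrict (\<lambda>i. if i < n then g i else i) {..<n} = g"
    using g by (auto simp: fun_eq_iff PiE_def extensional_def)
  show "(\<lambda>i. if i < n then g i else i) \<in> {\<sigma>. \<sigma> permutes {..<n}}"
    using injection_extends_permutes[OF \<open>g \<in> injections n {..<n}\<close>] by simp
next
  fix \<sigma> assume "\<sigma> \<in> {\<sigma>. \<sigma> permutes {..<n}}"
  then have \<sigma>: "\<sigma> permutes {..<n}" by simp
  show "(\<lambda>i. if i < n then restrict \<sigma> {..<n} i else i) = \<sigma>"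
    using permutes_not_in[OF \<sigma>] by (auto simp: fun_eq_iff)
  show "restrict \<sigma> {..<n} \<in> injections n {..<n}"
    using permutes_in_image[OF \<sigma>] permutes_inj_on[OF \<sigma>] by (auto simp: injections_def)
qed simp

lemma injection_sum_list:
  assumes "length xs = n"
  shows "injection_sum n {..<n} ((!) xs) = symmetrization n (formal_pure xs)"
proof -
  \<comment> \<open>An injection of \<open>{..<n}\<close> into itself is a permutation, and putting \<open>xs ! s\<close> into slot \<open>\<sigma> s\<close> permutes the list by the inverse of \<open>\<sigma>\<close>.\<close>
  define G where "G \<sigma> = (formal_pure (permute_list (inv_into UNIV \<sigma>) xs) :: ('a, 'b) formal_tensor)" for \<sigma>
  have "formal_pure (slot_products n {..<n} ((!) xs) g) = G (\<lambda>i. if i < n then g i else i)"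
    if g: "g \<in> injections n {..<n}" for g
  proof -
    define \<sigma> where "\<sigma> = (\<lambda>i. if i < n then g i else i)"
    have \<sigma>: "\<sigma> permutes {..<n}"
      unfolding \<sigma>_def using g by (rule injection_extends_permutes)
    have "{s \<in> {..<n}. g s = i} = {inv_into UNIV \<sigma> i}" if "i < n" for i
    proof -
      have "inv_into UNIV \<sigma> i < n" using permutes_in_image[OF permutes_inv[OF \<sigma>], of i] that by simp
      moreover have "s < n \<Longrightarrow> g s = i \<longleftrightarrow> s = inv_into UNIV \<sigma> i" for s
        using permutes_inv_eq[OF \<sigma>, of i s] by (auto simp: \<sigma>_def)
      ultimately show ?thesis by auto
    qed
    then have "slot_products n {..<n} ((!) xs) g = permute_list (inv_into UNIV \<sigma>) xs"
      by (intro nth_equalityI) (simp_all add: slot_products_def permute_list_def assms)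
    then show ?thesis by (simp add: G_def \<sigma>_def)
  qed
  then have "injection_sum n {..<n} ((!) xs) = (\<Sum>g\<in>injections n {..<n}. G (\<lambda>i. if i < n then g i else i))"
    unfolding injection_sum_def by (intro sum.cong refl)
  also have "\<dots> = (\<Sum>\<sigma> | \<sigma> permutes {..<n}. G \<sigma>)"
    by (rule permutes_reindex_injections)
  also have "\<dots> = (\<Sum>\<sigma> | \<sigma> permutes {..<n}. formal_pure (permute_list \<sigma> xs))"
    unfolding G_def by (rule sum_permutations_inverse[where f = "\<lambda>\<sigma>. formal_pure (permute_list \<sigma> xs)", symmetric])
  also have "\<dots> = symmetrization n (formal_pure xs)"
    by (simp add: symmetrization_def formal_pure_def permute_formal_single)
  finally show ?thesis .
qed

context tensor_algebra
begin

lemma tensor_bracket_eq: "tensor_bracket scale n a = cls (formal_bracket n a)"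
proof -
  have "tensor_bracket scale n a =
      (\<Oplus>\<^bsub>tensor_power scale n\<^esub>i\<in>{..<n}. cls (formal_pure ((replicate n 1)[i := a])))"
    by (simp add: tensor_bracket_def pure_tensor_def)
  then show ?thesis
    by (simp add: tensor_power_finsum formal_pure_in_formal_tensors formal_bracket_def)
qed

lemma formal_bracket_add: "cls (formal_bracket n (a + b)) = cls (formal_bracket n a + formal_bracket n b)"
proof -
  have "(\<Sum>i<n. formal_pure ((replicate n 1)[i := a + b]) - formal_pure ((replicate n 1)[i := a])
      - formal_pure ((replicate n 1)[i := b])) \<in> null"
    by (intro null_closed null_pure_add) simp_all
  then show ?thesis
    by (simp add: cls_eq_iff formal_bracket_def sum_subtractf sum.distrib algebra_simps)
qed

lemma formal_bracket_scale: "cls (formal_bracket n (scale c a)) = cls (formal_scale c (formal_bracket n a))"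
proof -
  have "(\<Sum>i<n. formal_pure ((replicate n 1)[i := scale c a]) -
      formal_scale c (formal_pure ((replicate n 1)[i := a]))) \<in> null"
    by (intro null_closed null_pure_scale) simp_all
  then show ?thesis
    by (simp add: cls_eq_iff formal_bracket_def sum_subtractf formal.scale_sum_right)
qed

lemma formal_bracket_one:
  "(formal_bracket n (1 :: 'a) :: ('a, 'k) formal_tensor) = formal_scale (of_nat n) (formal_pure (replicate n 1))"
proof -
  have "(replicate n 1)[i := 1] = replicate n (1 :: 'a)" for i
    by (cases "i < n") (simp_all add: list_update_same_conv list_update_beyond)
  then have "formal_bracket n 1 = (\<Sum>i<n. formal_pure (replicate n 1) :: ('a, 'k) formal_tensor)"
    by (simp only: formal_bracket_def)
  also have "\<dots> = formal_scale (of_nat n) (formal_pure (replicate n 1))"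
    by (simp only: formal.sum_constant_scale card_lessThan)
  finally show ?thesis .
qed

end

section \<open>Polynomial algebras\<close>

lemma Const_simps:
  "Const 0 = 0" "Const 1 = 1" "Const (a + b) = Const a + Const b" "Const (a * b) = Const a * Const b"
  "Const (- a') = - Const a'" "Const (of_nat m) = of_nat m"
  for a b :: "'k::comm_semiring_1" and a' :: "'r::comm_ring_1"
  by (simp_all add: Const_def single_add mult_single single_uminus)

lemma Const_times_single: "Const c * Poly_Mapping.single m d = Poly_Mapping.single m (c * d)"
  for c :: "'k::comm_semiring_1"
  by (simp add: Const_def mult_single)

lemma single_eq_prod_Var:
  "\<exists>vs. set vs = Poly_Mapping.keys m \<and>
    Poly_Mapping.single m (1 :: 'k::comm_semiring_1) = prod_list (map Var vs)"
proof -
  have "Poly_Mapping.keys m \<subseteq> UNIV" by simp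
  then show ?thesis
  proof (induction rule: poly_mapping_additive_induct)
    case zero
    show ?case by (intro exI[of _ "[]"]) simp
  next
    case (single v e)
    have "Poly_Mapping.single (Poly_Mapping.single v e) 1 = (Var v :: ('a, 'k) mpoly) ^ e"
    proof (induction e)
      case (Suc e)
      have "Poly_Mapping.single (Poly_Mapping.single v (Suc e)) 1 =
          Poly_Mapping.single (Poly_Mapping.single v 1) 1 * Poly_Mapping.single (Poly_Mapping.single v e) (1 :: 'k)"
        by (simp add: mult_single single_add[symmetric])
      then show ?case by (simp only: Suc.IH power_Suc) (simp add: Var_def)
    qed simp
    then show ?case
      by (intro exI[of _ "replicate e v"]) (simp add: prod_list_replicate)
  next
    case (add m m')
    then obtain vs vs' where
      "set vs = Poly_Mapping.keys m" "Poly_Mapping.single m (1 :: 'k) = prod_list (map Var vs)"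
      "set vs' = Poly_Mapping.keys m'" "Poly_Mapping.single m' (1 :: 'k) = prod_list (map Var vs')"
      by auto
    moreover have "Poly_Mapping.keys (m + m') = Poly_Mapping.keys m \<union> Poly_Mapping.keys m'"
      by (auto simp: in_keys_iff lookup_add)
    moreover have "Poly_Mapping.single (m + m') (1 :: 'k) =
        Poly_Mapping.single m 1 * Poly_Mapping.single m' 1"
      by (simp add: mult_single)
    ultimately show ?case by (intro exI[of _ "vs @ vs'"]) simp
  qed
qed

lemma carrier_poly_algebra:
  "p \<in> carrier (poly_algebra V) \<longleftrightarrow> Poly_Mapping.keys p \<subseteq> {m. Poly_Mapping.keys m \<subseteq> V}"
  by (auto simp: poly_algebra_def)

lemma poly_algebra_closed:
  fixes p q :: "('v, 'k::field) mpoly"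
  shows "(0 :: ('v, 'k) mpoly) \<in> carrier (poly_algebra V)"
    and "(1 :: ('v, 'k) mpoly) \<in> carrier (poly_algebra V)"
    and "(of_nat m :: ('v, 'k) mpoly) \<in> carrier (poly_algebra V)"
    and "(Const c :: ('v, 'k) mpoly) \<in> carrier (poly_algebra V)"
    and "v \<in> V \<Longrightarrow> (Var v :: ('v, 'k) mpoly) \<in> carrier (poly_algebra V)"
    and "p \<in> carrier (poly_algebra V) \<Longrightarrow> q \<in> carrier (poly_algebra V) \<Longrightarrow> p + q \<in> carrier (poly_algebra V)"
    and "p \<in> carrier (poly_algebra V) \<Longrightarrow> q \<in> carrier (poly_algebra V) \<Longrightarrow> p * q \<in> carrier (poly_algebra V)"
    and "p \<in> carrier (poly_algebra V) \<Longrightarrow> - p \<in> carrier (poly_algebra V)"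
proof -
  show C: "(Const c :: ('v, 'k) mpoly) \<in> carrier (poly_algebra V)" for c
    by (simp add: carrier_poly_algebra Const_def)
  show "(0 :: ('v, 'k) mpoly) \<in> carrier (poly_algebra V)"
    "(1 :: ('v, 'k) mpoly) \<in> carrier (poly_algebra V)"
    "(of_nat m :: ('v, 'k) mpoly) \<in> carrier (poly_algebra V)"
    using C[of 0] C[of 1] C[of "of_nat m"] by (simp_all add: Const_simps)
  show "v \<in> V \<Longrightarrow> (Var v :: ('v, 'k) mpoly) \<in> carrier (poly_algebra V)"
    by (simp add: carrier_poly_algebra Var_def)
  show "p \<in> carrier (poly_algebra V) \<Longrightarrow> q \<in> carrier (poly_algebra V) \<Longrightarrow> p + q \<in> carrier (poly_algebra V)"
    using keys_add[of p q] by (auto simp: carrier_poly_algebra)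
  show mult: "p \<in> carrier (poly_algebra V) \<Longrightarrow> q \<in> carrier (poly_algebra V) \<Longrightarrow> p * q \<in> carrier (poly_algebra V)"
    for p q :: "('v, 'k) mpoly"
  proof -
    assume pq: "p \<in> carrier (poly_algebra V)" "q \<in> carrier (poly_algebra V)"
    show "p * q \<in> carrier (poly_algebra V)"
      unfolding carrier_poly_algebra
    proof
      fix m assume "m \<in> Poly_Mapping.keys (p * q)"
      then obtain a b where "m = a + b" "a \<in> Poly_Mapping.keys p" "b \<in> Poly_Mapping.keys q"
        using keys_mult[of p q] by blast
      then show "m \<in> {m. Poly_Mapping.keys m \<subseteq> V}"
        using pq keys_add[of a b] by (fastforce simp: carrier_poly_algebra)
    qed
  qed
  show "- p \<in> carrier (poly_algebra V)" if "p \<in> carrier (poly_algebra V)"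
    using mult[OF C[of "-1"] that] by (simp add: Const_simps)
qed

lemma poly_algebra_sum_closed:
  "(\<And>i. i \<in> I \<Longrightarrow> f i \<in> carrier (poly_algebra V)) \<Longrightarrow> sum f I \<in> carrier (poly_algebra V)"
  by (induction I rule: infinite_finite_induct) (auto simp: poly_algebra_closed)

lemma poly_algebra_prod_closed:
  "(\<And>i. i \<in> I \<Longrightarrow> f i \<in> carrier (poly_algebra V)) \<Longrightarrow> prod f I \<in> carrier (poly_algebra V)"
  by (induction I rule: infinite_finite_induct) (auto simp: poly_algebra_closed)

lemma poly_algebra_simps:
  "mult (poly_algebra V) = (*)" "one (poly_algebra V) = 1" "zero (poly_algebra V) = 0"
  "add (poly_algebra V) = (+)" "smult (poly_algebra V) = (\<lambda>c p. Const c * p)"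
  by (simp_all add: poly_algebra_def)

lemma poly_algebra_cring: "cring (poly_algebra V)"
proof (rule cringI)
  show "abelian_group (poly_algebra V)"
  proof (rule abelian_groupI)
    fix p assume p: "p \<in> carrier (poly_algebra V)"
    then have "- p \<in> carrier (poly_algebra V)" by (rule poly_algebra_closed)
    then show "\<exists>q\<in>carrier (poly_algebra V). q \<oplus>\<^bsub>poly_algebra V\<^esub> p = \<zero>\<^bsub>poly_algebra V\<^esub>"
      by (rule bexI[rotated]) (simp add: poly_algebra_simps)
  qed (simp_all add: poly_algebra_closed poly_algebra_simps ac_simps)
  show "Group.comm_monoid (poly_algebra V)"
    by (rule comm_monoidI) (simp_all add: poly_algebra_closed poly_algebra_simps ac_simps)
qed (simp add: poly_algebra_simps distrib_right)

lemma poly_algebra_a_inv: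
  assumes "p \<in> carrier (poly_algebra V)"
  shows "\<ominus>\<^bsub>poly_algebra V\<^esub> p = - p"
proof -
  interpret cring "poly_algebra V" by (rule poly_algebra_cring)
  show ?thesis
    by (rule minus_equality) (simp_all add: assms poly_algebra_closed poly_algebra_simps)
qed

section \<open>Polarization of pure tensors\<close>

locale power_sum_algebra = tensor_algebra scale n
  for scale :: "'k::field \<Rightarrow> 'a::comm_ring_1 \<Rightarrow> 'a" and n +
  fixes M :: "'a set"
  assumes one_notin: "1 \<notin> M"
    and independent_basis: "\<not> dependent (insert 1 M)"
    and span_basis: "span (insert 1 M) = UNIV"
begin

abbreviation T where "T \<equiv> T_elem scale M n"
abbreviation polys :: "('a, 'k) mpoly set" where "polys \<equiv> carrier (poly_algebra M)"
abbreviation rep where "rep \<equiv> representation (insert 1 M)"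

text \<open>The sum defining \<open>T_elem\<close> ranges over a set that depends on \<open>a\<close>; a larger common index set makes
  linearity in \<open>a\<close> visible.\<close>

lemma T_elem_support:
  assumes "finite W" "W \<subseteq> M" "{w \<in> M. rep a w \<noteq> 0} \<subseteq> W"
  shows "T a = Const (rep a 1 * of_nat n) + (\<Sum>w\<in>W. Const (rep a w) * Var w)"
proof -
  have "(\<Sum>w | w \<in> M \<and> rep a w \<noteq> 0. Const (rep a w) * Var w) = (\<Sum>w\<in>W. Const (rep a w) * Var w)"
    using assms by (intro sum.mono_neutral_left) (auto simp: Const_simps)
  then show ?thesis by (simp add: T_elem_def Let_def)
qed

lemma finite_support: "finite {w \<in> M. rep a w \<noteq> 0}"
  by (rule finite_subset[OF _ finite_representation[of "insert 1 M" a]]) auto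

lemma T_add: "T (a + b) = T a + T b"
proof -
  let ?W = "{w \<in> M. rep a w \<noteq> 0} \<union> {w \<in> M. rep b w \<noteq> 0}"
  have ab: "rep (a + b) = (\<lambda>w. rep a w + rep b w)"
    using independent_basis by (rule representation_add) (simp_all add: span_basis)
  have W: "finite ?W" "?W \<subseteq> M" using finite_support by auto
  have "T (a + b) = Const (rep (a + b) 1 * of_nat n) + (\<Sum>w\<in>?W. Const (rep (a + b) w) * Var w)"
    using W by (rule T_elem_support) (auto simp: ab)
  moreover have "T a = Const (rep a 1 * of_nat n) + (\<Sum>w\<in>?W. Const (rep a w) * Var w)"
    using W by (rule T_elem_support) auto
  moreover have "T b = Const (rep b 1 * of_nat n) + (\<Sum>w\<in>?W. Const (rep b w) * Var w)"
    using W by (rule T_elem_support) auto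
  ultimately show ?thesis
    by (simp add: ab Const_simps distrib_right sum.distrib)
qed

lemma T_scale: "T (scale c a) = Const c * T a"
proof -
  let ?W = "{w \<in> M. rep a w \<noteq> 0}"
  have ca: "rep (scale c a) = (\<lambda>w. c * rep a w)"
    using independent_basis by (rule representation_scale) (simp add: span_basis)
  have W: "finite ?W" "?W \<subseteq> M" using finite_support by auto
  have "T (scale c a) = Const (rep (scale c a) 1 * of_nat n) + (\<Sum>w\<in>?W. Const (rep (scale c a) w) * Var w)"
    using W by (rule T_elem_support) (auto simp: ca)
  moreover have "T a = Const (rep a 1 * of_nat n) + (\<Sum>w\<in>?W. Const (rep a w) * Var w)"
    using W by (rule T_elem_support) auto
  ultimately show ?thesis
    by (simp add: ca Const_simps distrib_left sum_distrib_left mult.assoc)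
qed

lemma T_one: "T 1 = of_nat n"
proof -
  have "rep 1 = (\<lambda>w. if w = 1 then 1 else 0)"
    using independent_basis by (rule representation_basis) simp
  then show ?thesis
    using T_elem_support[of "{}" 1] one_notin by (auto simp: Const_simps)
qed

lemma T_basis:
  assumes "w \<in> M"
  shows "T w = Var w"
proof -
  have "rep w = (\<lambda>v. if v = w then 1 else 0)"
    using independent_basis by (rule representation_basis) (simp add: assms)
  moreover have "w \<noteq> 1" using assms one_notin by auto
  ultimately show ?thesis
    using T_elem_support[of "{w}" w] assms by (auto simp: Const_simps)
qed

lemma T_closed: "T a \<in> polys"
  unfolding T_elem_def Let_def
  by (intro poly_algebra_closed poly_algebra_sum_closed) auto

lemma scale_mult_right: "x * scale c y = scale c (x * y)"
  using scale_mult_left[of c y x] by (simp add: mult.commute)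

lemma cycle_sum_closed: "cycle_sum T S w \<in> polys"
proof -
  have "(-1 :: ('a, 'k) mpoly) ^ m \<in> polys" for m
    by (induction m) (simp_all add: poly_algebra_closed)
  then show ?thesis
    unfolding cycle_sum_def
    by (intro poly_algebra_closed poly_algebra_sum_closed poly_algebra_prod_closed T_closed)
qed

lemma cycle_sum_add:
  assumes "finite S" "j \<in> S"
  shows "cycle_sum T S (w(j := a + b)) = cycle_sum T S (w(j := a)) + cycle_sum T S (w(j := b))"
proof -
  obtain u r where ur: "\<And>a. cycle_sum T S (w(j := a)) = (\<Sum>P | partition_on S P. r P * T (u P * a))"
    by (rule cycle_sum_slot[OF assms, of T w]) (rule that)
  show ?thesis by (simp add: ur distrib_left T_add sum.distrib)
qed

lemma cycle_sum_scale:
  assumes "finite S" "j \<in> S"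
  shows "cycle_sum T S (w(j := scale c a)) = Const c * cycle_sum T S (w(j := a))"
proof -
  obtain u r where ur: "\<And>a. cycle_sum T S (w(j := a)) = (\<Sum>P | partition_on S P. r P * T (u P * a))"
    by (rule cycle_sum_slot[OF assms, of T w]) (rule that)
  show ?thesis by (simp add: ur scale_mult_right T_scale sum_distrib_left mult_ac)
qed

text \<open>An argument \<open>1\<close> can be dropped at the cost of a scalar: it contributes \<open>T\<^sub>1 = n\<close> as a block of its
  own, and it changes nothing when it is multiplied onto one of the other arguments. The scalar is
  zero for \<open>card S = n\<close>, and for \<open>card S < n\<close> it is invertible if the characteristic is \<open>0\<close> or
  exceeds \<open>n\<close>; both cases are used.\<close>

lemma cycle_sum_one:
  assumes "finite S" "a \<notin> S"
  shows "cycle_sum T (insert a S) (w(a := 1)) = (of_nat (card S) - of_nat n) * cycle_sum T S w"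
proof -
  have "cycle_sum T S (w(a := 1)) = cycle_sum T S w"
    using assms by (intro cycle_sum_cong) auto
  moreover have "cycle_sum T S ((w(a := 1))(j := (w(a := 1)) j * 1)) = cycle_sum T S w" if "j \<in> S" for j
    using assms by (intro cycle_sum_cong) auto
  ultimately show ?thesis
    by (simp add: cycle_sum_insert[OF assms] T_one algebra_simps)
qed

text \<open>The linear extension of \<open>w\<^sub>1 \<otimes> \<dots> \<otimes> w\<^sub>n \<mapsto> P(w\<^sub>1,\<dots>,w\<^sub>n)\<close>. By \<open>polarize_null\<close> it is a map on the
  tensor power; on symmetric tensors and modulo the relations between the power
  sums it is, up to the scalar \<open>(-1)\<^sup>n n!\<close>, the inverse of the map of the theorem.\<close>

definition polarize :: "('a, 'k) formal_tensor \<Rightarrow> ('a, 'k) mpoly" where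
  "polarize f = (\<Sum>xs\<in>Poly_Mapping.keys f. Const (Poly_Mapping.lookup f xs) * cycle_sum T {..<n} ((!) xs))"

lemma polarize_add: "polarize (f + g) = polarize f + polarize g"
  unfolding polarize_def
  by (rule setsum_keys_plus_distrib) (simp_all add: Const_simps distrib_right)

lemma polarize_single: "polarize (Poly_Mapping.single xs c) = Const c * cycle_sum T {..<n} ((!) xs)"
  unfolding polarize_def by (rule keys_sum_single) (simp add: Const_simps)

lemma polarize_zero [simp]: "polarize 0 = 0"
  by (simp add: polarize_def)

lemma polarize_pure: "polarize (formal_pure xs) = cycle_sum T {..<n} ((!) xs)"
  by (simp add: formal_pure_def polarize_single Const_simps)

lemma polarize_scale: "polarize (formal_scale c f) = Const c * polarize f"
proof -
  have "Poly_Mapping.keys f \<subseteq> UNIV" by simp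
  then show ?thesis
    by (induction rule: poly_mapping_additive_induct)
      (simp_all add: formal_scale_single polarize_single polarize_add formal.scale_right_distrib
        Const_simps distrib_left mult.assoc)
qed

lemma polarize_diff: "polarize (f - g) = polarize f - polarize g"
  using polarize_add[of "f - g" g] by simp

lemma polarize_sum: "polarize (\<Sum>i\<in>I. f i) = (\<Sum>i\<in>I. polarize (f i))"
  by (induction I rule: infinite_finite_induct) (simp_all add: polarize_add)

lemma polarize_null:
  assumes "f \<in> null"
  shows "polarize f = 0"
proof -
  have upd: "cycle_sum T {..<n} ((!) (xs[i := z])) = cycle_sum T {..<n} (((!) xs)(i := z))"
    if "length xs = n" "i < n" for xs i z
    using that by (intro cycle_sum_cong) (simp add: nth_list_update)
  show ?thesis
    using assms
  proof (induction rule: null_induct)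
    case subspace
    show ?case
      by (rule formal.subspaceI) (simp_all add: polarize_add polarize_scale)
  next
    case (add xs i x y)
    then show ?case
      by (simp add: polarize_diff polarize_pure upd cycle_sum_add)
  next
    case (scale xs i c x)
    then show ?case
      by (simp add: polarize_diff polarize_scale polarize_pure upd cycle_sum_scale)
  qed
qed

lemma polarize_permute:
  assumes "f \<in> tensors" "\<sigma> permutes {..<n}"
  shows "polarize (permute_formal \<sigma> f) = polarize f"
  using assms(1)
proof (induction rule: formal_tensors_induct)
  case (single xs c)
  have "cycle_sum T {..<n} ((!) (permute_list \<sigma> xs)) = cycle_sum T {..<n} ((!) xs \<circ> \<sigma>)"
    using single assms(2) by (intro cycle_sum_cong) (simp add: permute_list_nth)
  also have "\<dots> = cycle_sum T (\<sigma> ` {..<n}) ((!) xs)"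
    by (rule cycle_sum_reindex[symmetric]) (rule permutes_inj_on[OF assms(2)])
  finally show ?case
    by (simp add: permute_formal_single polarize_single permutes_image[OF assms(2)])
qed (simp_all add: permute_formal_add polarize_add)

lemma polarize_symmetrization:
  assumes "f \<in> tensors"
  shows "polarize (symmetrization n f) = of_nat (fact n) * polarize f"
proof -
  have "card {\<sigma>. \<sigma> permutes {..<n}} = fact n"
    by (rule card_permutations) simp_all
  then show ?thesis
    by (simp add: symmetrization_def polarize_sum polarize_permute[OF assms])
qed

end

section \<open>The ideal generated by the relations\<close>

context power_sum_algebra
begin

definition relations :: "('a, 'k) mpoly set" where
  "relations = {Psi scale M n w | w. \<forall>s\<in>{1..n + 1}. w s \<in> M}"

abbreviation relation_ideal where
  "relation_ideal \<equiv> Idl\<^bsub>poly_algebra M\<^esub> relations"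

lemma Psi_eq_cycle_sum: "Psi scale M n w = cycle_sum T {1..n + 1} w"
  by (simp only: Psi_def cycle_sum_def)

lemma relations_subset: "relations \<subseteq> polys"
  unfolding relations_def Psi_eq_cycle_sum using cycle_sum_closed by blast

lemma relation_ideal_closed:
  "relation_ideal \<subseteq> polys" "0 \<in> relation_ideal"
  "p \<in> relation_ideal \<Longrightarrow> q \<in> relation_ideal \<Longrightarrow> p + q \<in> relation_ideal"
  "p \<in> polys \<Longrightarrow> q \<in> relation_ideal \<Longrightarrow> p * q \<in> relation_ideal"
  "(\<And>i. i \<in> I \<Longrightarrow> f i \<in> relation_ideal) \<Longrightarrow> sum f I \<in> relation_ideal"
proof -
  interpret P: cring "poly_algebra M" by (rule poly_algebra_cring)
  interpret J: ideal relation_ideal "poly_algebra M"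
    by (rule P.genideal_ideal[OF relations_subset])
  show "relation_ideal \<subseteq> polys" by (rule J.a_subset)
  show 0: "0 \<in> relation_ideal"
    using J.zero_closed by (simp add: poly_algebra_simps)
  show add: "p \<in> relation_ideal \<Longrightarrow> q \<in> relation_ideal \<Longrightarrow> p + q \<in> relation_ideal" for p q
    using J.a_closed[of p q] by (simp add: poly_algebra_simps)
  show "p \<in> polys \<Longrightarrow> q \<in> relation_ideal \<Longrightarrow> p * q \<in> relation_ideal"
    using J.I_l_closed[of q p] by (simp add: poly_algebra_simps)
  show "(\<And>i. i \<in> I \<Longrightarrow> f i \<in> relation_ideal) \<Longrightarrow> sum f I \<in> relation_ideal"
    by (induction I rule: infinite_finite_induct) (simp_all add: 0 add)
qed

text \<open>The relations have arguments in \<open>M\<close>. Arguments equal to \<open>1\<close>, which multilinear extension also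
  requires, produce the zero polynomial by \<open>cycle_sum_one\<close>, as there are exactly \<open>n\<close> others.\<close>

lemma cycle_sum_basis_in_ideal:
  assumes S: "finite S" "card S = n + 1" and w: "\<And>s. s \<in> S \<Longrightarrow> w s \<in> insert 1 M"
  shows "cycle_sum T S w \<in> relation_ideal"
proof (cases "\<exists>s\<in>S. w s = 1")
  case True
  then obtain s where s: "s \<in> S" "w s = 1" by blast
  have "cycle_sum T (insert s (S - {s})) (w(s := 1)) = 0"
    using S s by (subst cycle_sum_one) auto
  moreover have "insert s (S - {s}) = S" "w(s := 1) = w" using s by auto
  ultimately show ?thesis by (simp add: relation_ideal_closed)
next
  case False
  have "card {1..n + 1} = card S" using S by simp
  then obtain f where f: "bij_betw f {1..n + 1} S"
    using finite_same_card_bij[OF finite_atLeastAtMost S(1)] by blast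
  have "\<forall>s\<in>{1..n + 1}. (w \<circ> f) s \<in> M"
    using f w False by (auto simp: bij_betw_def)
  then have "Psi scale M n (w \<circ> f) \<in> relations"
    unfolding relations_def by blast
  then have "cycle_sum T {1..n + 1} (w \<circ> f) \<in> relations"
    by (simp only: Psi_eq_cycle_sum)
  moreover have "cycle_sum T S w = cycle_sum T {1..n + 1} (w \<circ> f)"
    using f cycle_sum_reindex[of f "{1..n + 1}" T w] by (simp add: bij_betw_def)
  moreover interpret P: cring "poly_algebra M" by (rule poly_algebra_cring)
  have "relations \<subseteq> relation_ideal"
    by (rule P.genideal_self[OF relations_subset])
  ultimately show ?thesis by auto
qed

text \<open>Multilinearity: the arguments are released from \<open>insert 1 M\<close> to its span, which is all of \<open>A\<close>, one
  after the other. The set \<open>U\<close> in the induction contains the indices already released.\<close>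

lemma cycle_sum_in_ideal_card:
  assumes S: "finite S" "card S = n + 1"
  shows "cycle_sum T S w \<in> relation_ideal"
proof -
  have "\<forall>w. (\<forall>s\<in>S - U. w s \<in> insert 1 M) \<longrightarrow> cycle_sum T S w \<in> relation_ideal"
    if "finite U" "U \<subseteq> S" for U
    using that
  proof (induction U rule: finite_induct)
    case empty
    then show ?case using cycle_sum_basis_in_ideal[OF S] by auto
  next
    case (insert u U)
    show ?case
    proof (intro allI impI)
      fix w assume w: "\<forall>s\<in>S - insert u U. w s \<in> insert 1 M"
      have u: "u \<in> S" using insert.prems by simp
      have "w u \<in> span (insert 1 M)" by (simp add: span_basis)
      then have "cycle_sum T S (w(u := w u)) \<in> relation_ideal"
      proof (induction rule: span_induct)
        case base
        show ?case
        proof (rule subspaceI; unfold mem_Collect_eq)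
          have "cycle_sum T S (w(u := scale 0 0)) = 0"
            unfolding cycle_sum_scale[OF S(1) u] by (simp add: Const_simps)
          then show "cycle_sum T S (w(u := 0)) \<in> relation_ideal"
            by (simp add: relation_ideal_closed)
        qed (simp_all add: cycle_sum_add[OF S(1) u] cycle_sum_scale[OF S(1) u]
            relation_ideal_closed poly_algebra_closed)
      next
        case (step a)
        have "\<forall>s\<in>S - U. (w(u := a)) s \<in> insert 1 M" using w step by auto
        then show ?case using insert by blast
      qed
      then show "cycle_sum T S w \<in> relation_ideal" by simp
    qed
  qed
  from this[of S] S show ?thesis by simp
qed

text \<open>More than \<open>n + 1\<close> arguments reduce to \<open>n + 1\<close> by the recursion. It multiplies arguments, so the
  claim has to hold for all arguments in \<open>A\<close> and not only for those in \<open>M\<close>.\<close>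

lemma cycle_sum_in_ideal:
  assumes "finite S" "card S > n"
  shows "cycle_sum T S w \<in> relation_ideal"
  using assms
proof (induction "card S" arbitrary: S w)
  case 0
  then show ?case by simp
next
  case (Suc k)
  show ?case
  proof (cases "k = n")
    case True
    then show ?thesis
      using Suc.prems(1) Suc.hyps(2) by (intro cycle_sum_in_ideal_card) simp_all
  next
    case False
    from Suc.hyps(2) obtain a S' where S': "S = insert a S'" "a \<notin> S'" "card S' = k"
      using card_eq_SucD[of S k] by auto
    have fin: "finite S'" using Suc.prems(1) S'(1) by simp
    have "n < card S'" using Suc.prems(2) Suc.hyps(2) S'(3) False by linarith
    then have IH: "cycle_sum T S' w \<in> relation_ideal" for w
      by (rule Suc.hyps(1)[OF S'(3)[symmetric] fin])
    have "- T (w a) \<in> polys"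
      by (rule poly_algebra_closed(8)[OF T_closed])
    then have "- T (w a) * cycle_sum T S' w \<in> relation_ideal"
      using IH by (rule relation_ideal_closed(4))
    then show ?thesis
      unfolding S'(1) cycle_sum_insert[OF fin S'(2)]
      using relation_ideal_closed(5)[of S' "\<lambda>j. cycle_sum T S' (w(j := w j * w a))"] IH
      by (intro relation_ideal_closed(3)) blast+
  qed
qed

text \<open>The polynomials that are congruent to a polarized tensor modulo the ideal; the aim is \<open>polynomial_normal_form\<close>,
  which says that all polynomials in the given variables are of this kind.\<close>

definition normal_forms :: "('a, 'k) mpoly set" where
  "normal_forms = {polarize f + q | f q. f \<in> tensors \<and> q \<in> relation_ideal}"

lemma normal_forms_polarize: "f \<in> tensors \<Longrightarrow> polarize f \<in> normal_forms"
  unfolding normal_forms_def using relation_ideal_closed(2) by force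

lemma normal_forms_ideal: "q \<in> relation_ideal \<Longrightarrow> q \<in> normal_forms"
  unfolding normal_forms_def using formal_tensors_closed(1)[of n] by force

lemma normal_forms_add:
  assumes "p \<in> normal_forms" "q \<in> normal_forms"
  shows "p + q \<in> normal_forms"
proof -
  obtain f g i j where "p = polarize f + i" "q = polarize g + j"
    and fg: "f \<in> tensors" "g \<in> tensors" "i \<in> relation_ideal" "j \<in> relation_ideal"
    using assms by (auto simp: normal_forms_def)
  then have "p + q = polarize (f + g) + (i + j)"
    by (simp add: polarize_add)
  then show ?thesis
    unfolding normal_forms_def using fg formal_tensors_closed(2) relation_ideal_closed(3) by blast
qed

lemma normal_forms_scale:
  assumes "p \<in> normal_forms"
  shows "Const c * p \<in> normal_forms"
proof -
  obtain f i where "p = polarize f + i" and fi: "f \<in> tensors" "i \<in> relation_ideal"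
    using assms by (auto simp: normal_forms_def)
  then have "Const c * p = polarize (formal_scale c f) + Const c * i"
    by (simp add: polarize_scale distrib_left)
  moreover have "formal_scale c f \<in> tensors" "Const c * i \<in> relation_ideal"
    using fi by (auto intro: formal_tensors_closed relation_ideal_closed poly_algebra_closed)
  ultimately show ?thesis unfolding normal_forms_def by blast
qed

lemma normal_forms_zero: "0 \<in> normal_forms"
  by (intro normal_forms_ideal relation_ideal_closed)

lemma normal_forms_sum:
  "(\<And>i. i \<in> I \<Longrightarrow> f i \<in> normal_forms) \<Longrightarrow> sum f I \<in> normal_forms"
  by (induction I rule: infinite_finite_induct) (simp_all add: normal_forms_zero normal_forms_add)

end

section \<open>Straightening polynomials\<close>

locale power_sum_map = power_sum_algebra scale n M
  for scale :: "'k::field \<Rightarrow> 'a::comm_ring_1 \<Rightarrow> 'a" and n M +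
  fixes \<phi> :: "('a, 'k) mpoly \<Rightarrow> ('a, 'k) formal_tensor set"
  assumes char: "CHAR('k) = 0 \<or> CHAR('k) > n"
    and phi_hom: "\<phi> \<in> algebra_hom (poly_algebra M) (symmetric_tensors scale n)"
    and phi_Var: "w \<in> M \<Longrightarrow> \<phi> (Var w) = tensor_bracket scale n w"
begin

lemma of_nat_nonzero:
  assumes "0 < m" "m \<le> n"
  shows "(of_nat m :: 'k) \<noteq> 0"
proof
  assume "(of_nat m :: 'k) = 0"
  then have "CHAR('k) dvd m" by (simp add: of_nat_eq_0_iff_char_dvd)
  then show False using assms char by (auto dest: dvd_imp_le)
qed

lemma fact_nonzero: "(of_nat (fact n) :: 'k) \<noteq> 0"
proof -
  have "(of_nat (fact m) :: 'k) \<noteq> 0" if "m \<le> n" for m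
    using that
  proof (induction m)
    case (Suc m)
    have "(of_nat (fact (Suc m)) :: 'k) = of_nat (Suc m) * of_nat (fact m)"
      by (simp only: fact_Suc of_nat_mult of_nat_id)
    then show ?case using Suc of_nat_nonzero[of "Suc m"] by (simp only: mult_eq_0_iff) simp
  qed simp
  then show ?thesis by simp
qed

lemma cycle_sum_full_normal_form:
  assumes S: "finite S" "card S = n"
  shows "cycle_sum T S w \<in> normal_forms"
proof -
  have "card {..<n} = card S" using S by simp
  then obtain f where f: "bij_betw f {..<n} S"
    using finite_same_card_bij[OF finite_lessThan S(1)] by blast
  let ?xs = "map (w \<circ> f) [0..<n]"
  have "cycle_sum T S w = cycle_sum T {..<n} (w \<circ> f)"
    using f cycle_sum_reindex[of f "{..<n}" T w] by (simp add: bij_betw_def)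
  also have "\<dots> = cycle_sum T {..<n} ((!) ?xs)"
    by (intro cycle_sum_cong) simp
  also have "\<dots> = polarize (formal_pure ?xs)"
    by (simp add: polarize_pure)
  finally show ?thesis
    by (simp add: normal_forms_polarize formal_pure_in_formal_tensors)
qed

text \<open>With fewer than \<open>n\<close> arguments, fill up with ones: by \<open>cycle_sum_one\<close> each of them costs only the
  factor \<open>- (n - card S)\<close>, which is invertible by the assumption on the characteristic. The index
  type is \<open>nat\<close> so that a fresh index always exists.\<close>

lemma cycle_sum_normal_form:
  fixes S :: "nat set"
  assumes "finite S"
  shows "cycle_sum T S w \<in> normal_forms"
  using assms
proof (induction "n - card S" arbitrary: S w)
  case 0
  show ?case
  proof (cases "card S = n")
    case True
    with 0 show ?thesis by (intro cycle_sum_full_normal_form)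
  next
    case False
    with 0 show ?thesis by (intro normal_forms_ideal cycle_sum_in_ideal) simp_all
  qed
next
  case (Suc k)
  obtain a where a: "a \<notin> S" using ex_new_if_finite[OF _ Suc.prems] by auto
  let ?d = "of_nat (n - card S) :: 'k"
  have d: "?d \<noteq> 0" using Suc.hyps(2) by (intro of_nat_nonzero) simp_all
  have "cycle_sum T (insert a S) (w(a := 1)) \<in> normal_forms"
    using Suc.prems Suc.hyps(2) a by (intro Suc.hyps(1)) simp_all
  moreover have "cycle_sum T (insert a S) (w(a := 1)) = - Const ?d * cycle_sum T S w"
  proof -
    have "(of_nat (card S) - of_nat n :: ('a, 'k) mpoly) = - Const ?d"
      using Suc.hyps(2) by (simp only: Const_simps) (simp add: of_nat_diff)
    then show ?thesis by (simp only: cycle_sum_one[OF Suc.prems a])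
  qed
  moreover have "cycle_sum T S w = Const (- (1 / ?d)) * (- Const ?d * cycle_sum T S w)"
    using d by (simp add: mult.assoc[symmetric] Const_simps(4,5)[symmetric] Const_simps(2))
  ultimately show ?case using normal_forms_scale by metis
qed

text \<open>A product of \<open>k\<close> power sums is, up to sign, the leading term of a cycle sum, which has a normal form.
  The other terms of that cycle sum are shorter products of \<open>T\<^sub>b\<close> where \<open>b\<close> is a product in \<open>A\<close>. For
  this reason the statement is about arbitrary elements of \<open>A\<close>: the induction would not close for
  elements of \<open>M\<close> alone.\<close>

lemma prod_T_normal_form: "prod_list (map T as) \<in> normal_forms"
proof (induction "length as" arbitrary: as rule: less_induct)
  case less
  let ?S = "{..<length as}"
  let ?R = "\<Sum>P | partition_on ?S P \<and> P \<noteq> (\<lambda>s. {s}) ` ?S.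
        (-1) ^ card P * (\<Prod>B\<in>P. of_nat (fact (card B - 1)) * T (\<Prod>s\<in>B. as ! s))"
  have "?R \<in> normal_forms"
  proof (rule normal_forms_sum, clarify)
    fix P assume P: "partition_on ?S P" "P \<noteq> (\<lambda>s. {s}) ` ?S"
    have "finite P" using finite_elements[OF _ P(1)] by simp
    then obtain Bs where Bs: "set Bs = P" "distinct Bs"
      using finite_distinct_list by blast
    let ?bs = "map (\<lambda>B. \<Prod>s\<in>B. as ! s) Bs"
    have "card P < length as" using card_partition_less[OF _ P] by simp
    then have "length ?bs < length as" using Bs distinct_card by fastforce
    then have "prod_list (map T ?bs) \<in> normal_forms" by (rule less.hyps)
    then have "Const ((-1) ^ card P * of_nat (\<Prod>B\<in>P. fact (card B - 1))) * prod_list (map T ?bs)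
        \<in> normal_forms"
      by (rule normal_forms_scale)
    moreover have "prod_list (map T ?bs) = (\<Prod>B\<in>P. T (\<Prod>s\<in>B. as ! s))"
      using prod.distinct_set_conv_list[OF Bs(2), of "\<lambda>B. T (\<Prod>s\<in>B. as ! s)"]
      by (simp add: Bs(1) comp_def)
    moreover have "Const ((-1) ^ m :: 'k) = ((-1) ^ m :: ('a, 'k) mpoly)" for m
      by (induction m) (simp_all add: Const_simps)
    moreover have "Const (of_nat (\<Prod>B\<in>P. fact (card B - 1)) :: 'k) =
        (\<Prod>B\<in>P. of_nat (fact (card B - 1)) :: ('a, 'k) mpoly)"
      unfolding Const_simps(6) by (rule of_nat_prod)
    ultimately show "(-1) ^ card P * (\<Prod>B\<in>P. of_nat (fact (card B - 1)) * T (\<Prod>s\<in>B. as ! s))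
        \<in> normal_forms"
      by (simp only: Const_simps(4) prod.distrib mult.assoc)
  qed
  then have "Const (-1) * ?R \<in> normal_forms" by (rule normal_forms_scale)
  then have "cycle_sum T ?S ((!) as) + Const (-1) * ?R \<in> normal_forms"
    by (intro normal_forms_add cycle_sum_normal_form) simp_all
  moreover have "cycle_sum T ?S ((!) as) + Const (-1) * ?R = (-1) ^ length as * (\<Prod>s<length as. T (as ! s))"
    by (simp add: cycle_sum_leading Const_simps)
  moreover have "(\<Prod>s<length as. T (as ! s)) = prod_list (map T as)"
    by (simp add: prod.list_conv_set_nth atLeast0LessThan)
  ultimately have "(-1) ^ length as * prod_list (map T as) \<in> normal_forms" by simp
  then have "Const ((-1) ^ length as) * ((-1) ^ length as * prod_list (map T as)) \<in> normal_forms"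
    by (rule normal_forms_scale)
  moreover have "Const ((-1) ^ m :: 'k) * ((-1) ^ m * p) = p" for m and p :: "('a, 'k) mpoly"
    by (induction m) (simp_all add: Const_simps)
  ultimately show ?case by simp
qed

lemma polynomial_normal_form:
  assumes "p \<in> polys"
  shows "p \<in> normal_forms"
proof -
  have "Poly_Mapping.keys p \<subseteq> {m. Poly_Mapping.keys m \<subseteq> M}"
    using assms by (simp only: carrier_poly_algebra)
  then show ?thesis
  proof (induction rule: poly_mapping_additive_induct)
    case (single m c)
    from single_eq_prod_Var[of m] obtain vs where "set vs = Poly_Mapping.keys m \<and>
      Poly_Mapping.single m (1 :: 'k) = prod_list (map Var vs)" ..
    then have vs: "set vs = Poly_Mapping.keys m"
      "Poly_Mapping.single m (1 :: 'k) = prod_list (map Var vs)" by simp_all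
    have "set vs \<subseteq> M" using single vs(1) by simp
    then have "map Var vs = map T vs"
      by (intro map_cong refl T_basis[symmetric]) (rule subsetD)
    with vs(2) have "Poly_Mapping.single m (1 :: 'k) = prod_list (map T vs)"
      by (simp only:)
    then have "Poly_Mapping.single m c = Const c * prod_list (map T vs)"
      using Const_times_single[of c m "1 :: 'k"] by (simp only: mult_1_right)
    also have "\<dots> \<in> normal_forms"
      by (intro normal_forms_scale prod_T_normal_form)
    finally show ?case .
  qed (simp_all add: normal_forms_zero normal_forms_add)
qed

section \<open>The homomorphism on cycle sums\<close>

text \<open>Values of \<open>\<phi>\<close> are cosets; computing with representatives keeps sums and products of formal
  tensors available.\<close>

definition represents :: "('a, 'k) mpoly \<Rightarrow> ('a, 'k) formal_tensor \<Rightarrow> bool" where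
  "represents p f \<longleftrightarrow> p \<in> polys \<and> f \<in> tensors \<and> \<phi> p = cls f"

lemma phi_ring_hom: "\<phi> \<in> ring_hom (poly_algebra M) (symmetric_tensors scale n)"
  using phi_hom by (simp add: algebra_hom_def)

lemma symmetric_tensors_simps:
  "mult (symmetric_tensors scale n) = mult (tensor_power scale n)"
  "add (symmetric_tensors scale n) = add (tensor_power scale n)"
  "one (symmetric_tensors scale n) = one (tensor_power scale n)"
  "zero (symmetric_tensors scale n) = zero (tensor_power scale n)"
  "smult (symmetric_tensors scale n) = smult (tensor_power scale n)"
  by (simp_all add: symmetric_tensors_def)

lemma represents_add:
  assumes "represents p f" "represents q g"
  shows "represents (p + q) (f + g)"
  using assms ring_hom_add[OF phi_ring_hom, of p q]
  by (simp add: represents_def poly_algebra_simps symmetric_tensors_simps poly_algebra_closed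
      formal_tensors_closed cls_add)

lemma represents_mult:
  assumes "represents p f" "represents q g"
  shows "represents (p * q) (formal_mult f g)"
  using assms ring_hom_mult[OF phi_ring_hom, of p q]
  by (simp add: represents_def poly_algebra_simps symmetric_tensors_simps poly_algebra_closed
      formal_mult_closed cls_mult)

lemma represents_scale:
  assumes "represents p f"
  shows "represents (Const c * p) (formal_scale c f)"
proof -
  have "\<phi> (c \<odot>\<^bsub>poly_algebra M\<^esub> p) = c \<odot>\<^bsub>symmetric_tensors scale n\<^esub> \<phi> p"
    using phi_hom assms by (simp add: algebra_hom_def represents_def)
  then show ?thesis
    using assms
    by (simp add: represents_def poly_algebra_simps symmetric_tensors_simps poly_algebra_closed
        formal_tensors_closed cls_smult)
qed

lemma represents_one: "represents 1 (formal_pure (replicate n 1))"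
  using ring_hom_one[OF phi_ring_hom]
  by (simp add: represents_def poly_algebra_simps symmetric_tensors_simps poly_algebra_closed
      formal_pure_in_formal_tensors tensor_power_one)

lemma represents_zero: "represents 0 0"
  using represents_scale[OF represents_one, of 0] by (simp add: Const_simps)

lemma represents_sum:
  "(\<And>i. i \<in> I \<Longrightarrow> represents (p i) (f i)) \<Longrightarrow> represents (sum p I) (sum f I)"
  by (induction I rule: infinite_finite_induct) (simp_all add: represents_zero represents_add)

lemma represents_uminus: "represents p f \<Longrightarrow> represents (- p) (- f)"
  using represents_scale[of p f "-1"] by (simp add: Const_simps)

text \<open>Both sides are linear in \<open>a\<close>, so it is enough to know them on the basis: on \<open>M\<close> this is the
  assumption on \<open>\<phi>\<close>, and at \<open>1\<close> both are \<open>n\<close>.\<close>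

lemma represents_T: "represents (T a) (formal_bracket n a)"
proof -
  have "a \<in> span (insert 1 M)" by (simp add: span_basis)
  then have "\<phi> (T a) = cls (formal_bracket n a)"
  proof (induction rule: span_induct)
    case base
    show ?case
    proof (rule subspaceI; unfold mem_Collect_eq)
      have T: "represents (T a) (formal_bracket n a)" if "\<phi> (T a) = cls (formal_bracket n a)" for a
        using that by (simp add: represents_def T_closed formal_bracket_closed)
      show "\<phi> (T (a + b)) = cls (formal_bracket n (a + b))"
        if "\<phi> (T a) = cls (formal_bracket n a)" "\<phi> (T b) = cls (formal_bracket n b)" for a b
        using represents_add[OF T[OF that(1)] T[OF that(2)]]
        by (simp add: represents_def T_add formal_bracket_add)
      show scale: "\<phi> (T (scale c a)) = cls (formal_bracket n (scale c a))"
        if "\<phi> (T a) = cls (formal_bracket n a)" for a c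
        using represents_scale[OF T[OF that]]
        by (simp add: represents_def T_scale formal_bracket_scale)
      have "\<phi> (T (scale 0 0)) = cls (formal_bracket n (scale 0 0))"
        unfolding T_scale formal_bracket_scale using represents_zero
        by (simp add: represents_def Const_simps)
      then show "\<phi> (T 0) = cls (formal_bracket n 0)" by simp
    qed
  next
    case (step a)
    then consider "a = 1" | "a \<in> M" by auto
    then show ?case
    proof cases
      case 1
      have "represents (Const (of_nat n) * 1) (formal_scale (of_nat n) (formal_pure (replicate n 1)))"
        by (rule represents_scale[OF represents_one])
      then show ?thesis using 1 by (simp add: represents_def T_one formal_bracket_one Const_simps)
    next
      case 2
      then show ?thesis by (simp add: T_basis phi_Var tensor_bracket_eq)
    qed
  qed
  then show ?thesis by (simp add: represents_def T_closed formal_bracket_closed)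
qed

text \<open>By \<open>represents_T\<close>, the recursions \<open>cycle_sum_insert\<close> and \<open>injection_sum_insert\<close> correspond to each
  other under \<open>\<phi>\<close>, up to the sign that each new argument contributes.\<close>

lemma represents_cycle_sum:
  assumes "finite S"
  shows "represents (cycle_sum T S w) (formal_scale ((-1) ^ card S) (injection_sum n S w))"
  using assms
proof (induction S arbitrary: w rule: finite_induct)
  case empty
  show ?case by (simp add: cycle_sum_empty injection_sum_empty represents_one)
next
  case (insert a S)
  let ?c = "(-1) ^ card S :: 'k"
  have "represents (- (T (w a) * cycle_sum T S w) + (\<Sum>j\<in>S. cycle_sum T S (w(j := w j * w a))))
      (- (formal_mult (formal_bracket n (w a)) (formal_scale ?c (injection_sum n S w))) +
        (\<Sum>j\<in>S. formal_scale ?c (injection_sum n S (w(j := w j * w a)))))"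
    by (intro represents_add represents_uminus represents_mult represents_sum represents_T insert.IH)
  moreover have "- (formal_mult (formal_bracket n (w a)) (formal_scale ?c (injection_sum n S w))) +
        (\<Sum>j\<in>S. formal_scale ?c (injection_sum n S (w(j := w j * w a)))) =
      formal_scale ((-1) ^ card (insert a S)) (injection_sum n (insert a S) w)"
    by (simp add: insert.hyps injection_sum_insert formal_mult_scale_right
        formal.scale_right_diff_distrib formal.scale_sum_right sum_negf)
  ultimately show ?case by (simp add: cycle_sum_insert[OF insert.hyps])
qed

lemma represents_polarize:
  assumes "f \<in> tensors"
  shows "represents (polarize f) (formal_scale ((-1) ^ n) (symmetrization n f))"
  using assms
proof (induction rule: formal_tensors_induct)
  case zero
  show ?case by (simp add: represents_zero)
next
  case (single xs c)
  have "represents (cycle_sum T {..<n} ((!) xs)) (formal_scale ((-1) ^ n) (symmetrization n (formal_pure xs)))"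
    using represents_cycle_sum[of "{..<n}" "(!) xs"] single by (simp add: injection_sum_list)
  then have "represents (Const c * cycle_sum T {..<n} ((!) xs))
      (formal_scale c (formal_scale ((-1) ^ n) (symmetrization n (formal_pure xs))))"
    by (rule represents_scale)
  moreover have "symmetrization n (Poly_Mapping.single xs c) = formal_scale c (symmetrization n (formal_pure xs))"
    by (simp add: symmetrization_def formal_pure_def permute_formal_single formal.scale_sum_right
        formal_scale_single)
  ultimately show ?case by (simp add: polarize_single mult.commute)
next
  case (add f g)
  then show ?case
    by (simp add: polarize_add symmetrization_add formal.scale_right_distrib represents_add)
qed

section \<open>Surjectivity and kernel\<close>

text \<open>If \<open>f\<close> represents a symmetric tensor, its symmetrization is \<open>n! f\<close> modulo the relations. So
  \<open>polarize f\<close>, divided by \<open>(-1)\<^sup>n n!\<close>, is a preimage.\<close>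

lemma symmetric_tensor_in_image:
  assumes "X \<in> carrier (symmetric_tensors scale n)"
  shows "X \<in> \<phi> ` polys"
proof -
  obtain f where f: "f \<in> tensors" "X = cls f"
    and inv: "\<And>\<sigma>. \<sigma> permutes {..<n} \<Longrightarrow> permute_formal \<sigma> ` X = X"
    using assms by (auto simp: symmetric_tensors_def carrier_tensor_power)
  have "permute_formal \<sigma> f - f \<in> null" if "\<sigma> permutes {..<n}" for \<sigma>
    using inv[OF that] cls_self[of f] by (auto simp: f(2) mem_cls_iff)
  then have "(\<Sum>\<sigma> | \<sigma> permutes {..<n}. permute_formal \<sigma> f - f) \<in> null"
    by (intro null_closed(6)) simp
  moreover have "(\<Sum>\<sigma> | \<sigma> permutes {..<n}. permute_formal \<sigma> f - f)
      = symmetrization n f - formal_scale (of_nat (fact n)) f"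
    using card_permutations[of "{..<n}" n]
    by (simp add: sum_subtractf symmetrization_def formal.sum_constant_scale)
  ultimately have sym: "symmetrization n f - formal_scale (of_nat (fact n)) f \<in> null" by simp
  let ?c = "(-1) ^ n / of_nat (fact n) :: 'k"
  have "represents (Const ?c * polarize f)
      (formal_scale ?c (formal_scale ((-1) ^ n) (symmetrization n f)))"
    by (intro represents_scale represents_polarize f)
  moreover have "formal_scale ?c (formal_scale ((-1) ^ n) (symmetrization n f)) - f =
      formal_scale (1 / of_nat (fact n)) (symmetrization n f - formal_scale (of_nat (fact n)) f)"
    using fact_nonzero
    by (simp add: formal.scale_right_diff_distrib power_mult_distrib[symmetric])
  ultimately have "Const ?c * polarize f \<in> polys" "\<phi> (Const ?c * polarize f) = cls f"
    using null_closed(5)[OF sym] by (simp_all add: represents_def cls_eq_iff)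
  then show ?thesis by (auto simp: f(2) image_iff)
qed

lemma a_kernel_eq: "a_kernel (poly_algebra M) (symmetric_tensors scale n) \<phi> = {p \<in> polys. \<phi> p = cls 0}"
  by (simp add: a_kernel_def kernel_def symmetric_tensors_simps tensor_power_zero)

lemma phi_represented:
  assumes "p \<in> polys"
  obtains f where "represents p f"
proof -
  have "\<phi> p \<in> carrier (symmetric_tensors scale n)"
    by (rule ring_hom_closed[OF phi_ring_hom assms])
  then obtain f where "f \<in> tensors" "\<phi> p = cls f"
    by (auto simp: symmetric_tensors_def carrier_tensor_power)
  then show ?thesis using assms by (intro that[of f]) (simp add: represents_def)
qed

lemma kernel_ideal: "ideal {p \<in> polys. \<phi> p = cls 0} (poly_algebra M)"
proof -
  interpret P: cring "poly_algebra M" by (rule poly_algebra_cring)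
  have rep0: "represents p 0" if "p \<in> {p \<in> polys. \<phi> p = cls 0}" for p
    using that by (simp add: represents_def formal_tensors_closed)
  have mult: "p * q \<in> {p \<in> polys. \<phi> p = cls 0}" if p: "p \<in> {p \<in> polys. \<phi> p = cls 0}" and q: "q \<in> polys" for p q
  proof -
    obtain g where "represents q g" using q by (rule phi_represented)
    from represents_mult[OF rep0[OF p] this] show ?thesis
      by (simp add: represents_def)
  qed
  show ?thesis
  proof (rule idealI)
    show "ring (poly_algebra M)" by (rule P.ring_axioms)
    show "subgroup {p \<in> polys. \<phi> p = cls 0} (add_monoid (poly_algebra M))"
    proof (rule P.add.subgroupI)
      show "{p \<in> polys. \<phi> p = cls 0} \<noteq> {}"
        using represents_zero by (auto simp: represents_def)
      show "\<ominus>\<^bsub>poly_algebra M\<^esub> p \<in> {p \<in> polys. \<phi> p = cls 0}" if "p \<in> {p \<in> polys. \<phi> p = cls 0}" for p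
        using represents_uminus[OF rep0[OF that]] that
        by (simp add: poly_algebra_a_inv represents_def)
      show "p \<oplus>\<^bsub>poly_algebra M\<^esub> q \<in> {p \<in> polys. \<phi> p = cls 0}"
        if "p \<in> {p \<in> polys. \<phi> p = cls 0}" "q \<in> {p \<in> polys. \<phi> p = cls 0}" for p q
        using represents_add[OF rep0[OF that(1)] rep0[OF that(2)]]
        by (simp add: poly_algebra_simps represents_def)
    qed auto
  qed (use mult in \<open>simp_all add: poly_algebra_simps mult.commute\<close>)
qed

text \<open>The pigeonhole principle: \<open>n + 1\<close> factors cannot occupy distinct slots, so the sum over injections
  is empty.\<close>

lemma relation_ideal_subset_kernel: "relation_ideal \<subseteq> {p \<in> polys. \<phi> p = cls 0}"
proof -
  interpret P: cring "poly_algebra M" by (rule poly_algebra_cring)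
  have "cycle_sum T {1..n + 1} w \<in> {p \<in> polys. \<phi> p = cls 0}" for w
    using represents_cycle_sum[of "{1..n + 1}" w]
    by (simp add: injection_sum_too_many represents_def)
  then have "relations \<subseteq> {p \<in> polys. \<phi> p = cls 0}"
    unfolding relations_def Psi_eq_cycle_sum by blast
  then show ?thesis by (rule P.genideal_minimal[OF kernel_ideal])
qed

text \<open>Write \<open>p\<close> as \<open>polarize f\<close> plus an element of the ideal. The image of \<open>p\<close> is the symmetrization of \<open>f\<close>,
  up to sign, and \<open>polarize\<close> recovers \<open>n! polarize f\<close> from it.\<close>

lemma kernel_subset_relation_ideal:
  assumes p: "p \<in> polys" "\<phi> p = cls 0"
  shows "p \<in> relation_ideal"
proof -
  obtain f q where pq: "p = polarize f + q" and f: "f \<in> tensors" and q: "q \<in> relation_ideal"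
    using polynomial_normal_form[OF p(1)] by (auto simp: normal_forms_def)
  have "represents q 0"
    using relation_ideal_subset_kernel q by (auto simp: represents_def formal_tensors_closed)
  from represents_add[OF represents_polarize[OF f] this]
  have "cls 0 = cls (formal_scale ((-1) ^ n) (symmetrization n f))"
    using p by (simp add: pq[symmetric] represents_def)
  then have "formal_scale ((-1) ^ n) (symmetrization n f) \<in> null"
    using cls_eq_iff[of "formal_scale ((-1) ^ n) (symmetrization n f)" 0] by simp
  from null_closed(5)[OF this, of "(-1) ^ n"] have "symmetrization n f \<in> null"
    by (simp add: power_mult_distrib[symmetric])
  then have "of_nat (fact n) * polarize f = 0"
    using polarize_null polarize_symmetrization[OF f] by simp
  then have "Const (1 / of_nat (fact n)) * (Const (of_nat (fact n)) * polarize f) = 0"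
    by (simp only: Const_simps) simp
  then have "polarize f = 0"
    using fact_nonzero by (simp only: mult.assoc[symmetric] Const_simps(4)[symmetric]) (simp add: Const_simps(2))
  then show ?thesis using pq q by simp
qed

end

theorem theorem1:
  fixes n :: nat
    and scale :: "'k::field \<Rightarrow> 'a::comm_ring_1 \<Rightarrow> 'a"
    and M :: "'a set"
    and \<phi> :: "('a, 'k) mpoly \<Rightarrow> ('a, 'k) formal_tensor set"
  assumes "n > 0"
    and "CHAR('k) = 0 \<or> CHAR('k) > n"
    and "commutative_algebra scale"
    and "1 \<notin> M"
    and "\<not> module.dependent scale (insert 1 M)"
    and "module.span scale (insert 1 M) = UNIV"
    and "\<phi> \<in> algebra_hom (poly_algebra M) (symmetric_tensors scale n)"
    and "\<forall>w\<in>M. \<phi> (Var w) = tensor_bracket scale n w"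
  shows "\<phi> ` carrier (poly_algebra M) = carrier (symmetric_tensors scale n) \<and>
         a_kernel (poly_algebra M) (symmetric_tensors scale n) \<phi> =
           Idl\<^bsub>poly_algebra M\<^esub> {Psi scale M n w | w. \<forall>s\<in>{1..n + 1}. w s \<in> M}"
proof -
  interpret power_sum_map scale n M \<phi>
    by (intro power_sum_map.intro power_sum_algebra.intro tensor_algebra.intro
        power_sum_algebra_axioms.intro power_sum_map_axioms.intro assms)
      (use assms(8) in blast)
  show ?thesis
  proof (intro conjI equalityI subsetI)
    show "X \<in> carrier (symmetric_tensors scale n)" if "X \<in> \<phi> ` carrier (poly_algebra M)" for X
      using that ring_hom_closed[OF phi_ring_hom] by auto
    show "X \<in> \<phi> ` carrier (poly_algebra M)" if "X \<in> carrier (symmetric_tensors scale n)" for X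
      using that by (rule symmetric_tensor_in_image)
    show "p \<in> Idl\<^bsub>poly_algebra M\<^esub> {Psi scale M n w | w. \<forall>s\<in>{1..n + 1}. w s \<in> M}"
      if "p \<in> a_kernel (poly_algebra M) (symmetric_tensors scale n) \<phi>" for p
      using that kernel_subset_relation_ideal[of p] by (simp add: a_kernel_eq relations_def)
    show "p \<in> a_kernel (poly_algebra M) (symmetric_tensors scale n) \<phi>"
      if "p \<in> Idl\<^bsub>poly_algebra M\<^esub> {Psi scale M n w | w. \<forall>s\<in>{1..n + 1}. w s \<in> M}" for p
      using that relation_ideal_subset_kernel by (auto simp: a_kernel_eq relations_def)
  qed
qed

end
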